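(* If $T=(T_1,\ldots,T_k)$ is a $k$-tuple in the regular $\Lambda$-polyball $\mathbf B_\Lambda(\mathcal H)$, then $$\|p(\{T_{i,s}\},\{T_{i,s}^*\})\|\le\|p(\{S_{i,s}\},\{S_{i,s}^*\})\|$$ for any polynomial (finite sum) of the form $$p(\{S_{i,s}\},\{S_{i,s}^*\})=\sum a_{(\alpha_1,\ldots,\alpha_k,\beta_1,\ldots,\beta_k)}S_{1,\alpha_1}\cdots S_{k,\alpha_k}S_{1,\beta_1}^*\cdots S_{k,\beta_k}^*,$$ with $a_{(\alpha_1,\ldots,\alpha_k,\beta_1,\ldots,\beta_k)}\in\mathbb C$, $\alpha_i,\beta_i\in\mathbb F_{n_i}^+$, where $$p(\{T_{i,s}\},\{T_{i,s}^*\}):=\sum a_{(\alpha_1,\ldots,\alpha_k,\beta_1,\ldots,\beta_k)}T_{1,\alpha_1}\cdots T_{k,\alpha_k}T_{1,\beta_1}^*\cdots T_{k,\beta_k}^*.$$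
   Context: Fix integers $k\ge1$, $n_1,\ldots,n_k\ge 1$ and, for $i\ne j$ in $\{1,\ldots,k\}$, an $n_i\times n_j$ matrix $\Lambda_{i,j}=[\lambda_{i,j}(s,t)]$ with entries in $\mathbb T=\{z\in\mathbb C:|z|=1\}$, such that $\lambda_{j,i}(t,s)=\overline{\lambda_{i,j}(s,t)}$. For $T=(T_1,\ldots,T_k)$ with $T_i=[T_{i,1}\cdots T_{i,n_i}]$, $T_{i,s}\in B(\mathcal H)$, let $\Phi_{rT_i}(X):=\sum_{s=1}^{n_i}r^2T_{i,s}XT_{i,s}^*$. The regular $\Lambda$-polyball $\mathbf B_\Lambda(\mathcal H)$ is the set of $T$ with $\sum_sT_{i,s}T_{i,s}^*\le I$ for each $i$, $T_{i,s}T_{j,t}=\lambda_{i,j}(s,t)T_{j,t}T_{i,s}$ for all $i\ne j$, $s,t$, and $(id-\Phi_{rT_1})\circ\cdots\circ(id-\Phi_{rT_k})(I)\ge0$ for all $r\in[0,1)$. $\mathbb F_{n_i}^+$ is the unital free semigroup with generators $g_1^i,\ldots,g_{n_i}^i$ and neutral element $g_0^i$; $T_{i,\alpha}:=T_{i,p_1}\cdots T_{i,p_m}$ for $\alpha=g^i_{p_1}\cdots g^i_{p_m}$, $T_{i,g_0^i}:=I$, and $T_{i,\alpha}^*=(T_{i,\alpha})^*$; similarly for $S$. The standard $k$-tuple $S=(S_1,\ldots,S_k)$, $S_i=[S_{i,1}\cdots S_{i,n_i}]$, acts on $\ell^2(\mathbb F_{n_1}^+\times\cdots\times\mathbb F_{n_k}^+)$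 with standard basis $\chi_{(\alpha_1,\ldots,\alpha_k)}$ by $$S_{i,s}\chi_{(\alpha_1,\ldots,\alpha_k)}=\boldsymbol\lambda_{i,1}(s,\alpha_1)\cdots\boldsymbol\lambda_{i,i-1}(s,\alpha_{i-1})\chi_{(\alpha_1,\ldots,\alpha_{i-1},g_s^i\alpha_i,\alpha_{i+1},\ldots,\alpha_k)},$$ where $\boldsymbol\lambda_{i,j}(s,g^j_{j_1}\cdots g^j_{j_q})=\prod_{b=1}^q\lambda_{i,j}(s,j_b)$, $\boldsymbol\lambda_{i,j}(s,g_0^j)=1$ (no factor if $i=1$). *)

theory Defs
  imports "HOL-Analysis.Analysis"
begin

section \<open>Complex Hilbert spaces\<close>

text \<open>The real inner product of the superclass is the real part of the complex one, so norm,
  topology and completeness are the library's. The form is linear in its first argument.\<close>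

class complex_inner = real_inner +
  fixes scaleC :: "complex \<Rightarrow> 'a \<Rightarrow> 'a" (infixr \<open>*\<^sub>C\<close> 75)
    and cinner :: "'a \<Rightarrow> 'a \<Rightarrow> complex"
  assumes scaleC_add_right: "c *\<^sub>C (x + y) = c *\<^sub>C x + c *\<^sub>C y"
    and scaleC_add_left: "(c + d) *\<^sub>C x = c *\<^sub>C x + d *\<^sub>C x"
    and scaleC_scaleC: "c *\<^sub>C (d *\<^sub>C x) = (c * d) *\<^sub>C x"
    and scaleR_scaleC: "r *\<^sub>R x = complex_of_real r *\<^sub>C x"
    and cinner_commute: "cinner x y = cnj (cinner y x)"
    and cinner_add_left: "cinner (x + y) z = cinner x z + cinner y z"
    and cinner_scaleC_left: "cinner (c *\<^sub>C x) y = c * cinner x y"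
    and inner_eq_Re_cinner: "inner x y = Re (cinner x y)"

class chilbert_space = complex_inner + complete_space

definition bounded_clinear :: "('a::complex_inner \<Rightarrow> 'b::complex_inner) \<Rightarrow> bool" where
  "bounded_clinear A \<longleftrightarrow> bounded_linear A \<and> (\<forall>c x. A (c *\<^sub>C x) = c *\<^sub>C A x)"

definition positive_op :: "('a::complex_inner \<Rightarrow> 'a) \<Rightarrow> bool" where
  "positive_op A \<longleftrightarrow> (\<forall>x. cinner (A x) x \<in> \<real>\<^sub>\<ge>\<^sub>0)"

text \<open>In the next two definitions \<open>V\<close> is a closed complex subspace, regarded as a Hilbert space in
  its own right, and \<open>A\<close> is an operator mapping \<open>V\<close> into \<open>V\<close>; its values off \<open>V\<close> play no role.
  With \<open>V = UNIV\<close> the second one is \<^const>\<open>onorm\<close>.\<close>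

definition cadjoint_on :: "'a::complex_inner set \<Rightarrow> ('a \<Rightarrow> 'a) \<Rightarrow> 'a \<Rightarrow> 'a" where
  "cadjoint_on V A y = (THE z. z \<in> V \<and> (\<forall>x\<in>V. cinner (A x) y = cinner x z))"

definition onorm_on :: "'a::complex_inner set \<Rightarrow> ('a \<Rightarrow> 'a) \<Rightarrow> real" where
  "onorm_on V A = (SUP x\<in>V. norm (A x) / norm x)"

abbreviation cadjoint :: "('a::complex_inner \<Rightarrow> 'a) \<Rightarrow> 'a \<Rightarrow> 'a" where
  "cadjoint \<equiv> cadjoint_on UNIV"


section \<open>Square-summable families\<close>

lemma square_summable_add:
  fixes f g :: "'a \<Rightarrow> complex"
  assumes "(\<lambda>x. (cmod (f x))\<^sup>2) summable_on UNIV" "(\<lambda>x. (cmod (g x))\<^sup>2) summable_on UNIV"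
  shows "(\<lambda>x. (cmod (f x + g x))\<^sup>2) summable_on UNIV"
proof (rule summable_on_comparison_test)
  show "(\<lambda>x. 2 * (cmod (f x))\<^sup>2 + 2 * (cmod (g x))\<^sup>2) summable_on UNIV"
    by (intro summable_on_add summable_on_cmult_right assms)
  fix x
  have "(cmod (f x + g x))\<^sup>2 \<le> (cmod (f x) + cmod (g x))\<^sup>2"
    by (intro power_mono norm_triangle_ineq) auto
  also have "\<dots> \<le> 2 * (cmod (f x))\<^sup>2 + 2 * (cmod (g x))\<^sup>2"
    using sum_squares_bound[of "cmod (f x)" "cmod (g x)"] by (simp add: power2_sum)
  finally show "(cmod (f x + g x))\<^sup>2 \<le> 2 * (cmod (f x))\<^sup>2 + 2 * (cmod (g x))\<^sup>2" .
qed auto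

lemma square_summable_scale:
  fixes f :: "'a \<Rightarrow> complex"
  assumes "(\<lambda>x. (cmod (f x))\<^sup>2) summable_on UNIV"
  shows "(\<lambda>x. (cmod (c * f x))\<^sup>2) summable_on UNIV"
  using summable_on_cmult_right[OF assms, of "(cmod c)\<^sup>2"] by (simp add: norm_mult power_mult_distrib)

lemma square_summable_mult:
  fixes f g :: "'a \<Rightarrow> complex"
  assumes "(\<lambda>x. (cmod (f x))\<^sup>2) summable_on UNIV" "(\<lambda>x. (cmod (g x))\<^sup>2) summable_on UNIV"
  shows "(\<lambda>x. f x * cnj (g x)) summable_on UNIV"
proof (rule Infinite_Sum.abs_summable_summable, rule Infinite_Sum.abs_summable_on_comparison_test')
  show "(\<lambda>x. (cmod (f x))\<^sup>2 + (cmod (g x))\<^sup>2) summable_on UNIV"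
    by (intro summable_on_add assms)
  fix x
  have "0 \<le> cmod (f x) * cmod (g x)" by simp
  then show "norm (f x * cnj (g x)) \<le> (cmod (f x))\<^sup>2 + (cmod (g x))\<^sup>2"
    using sum_squares_bound[of "cmod (f x)" "cmod (g x)"] unfolding norm_mult complex_mod_cnj by linarith
qed

typedef 'a ell2 = "{f :: 'a \<Rightarrow> complex. (\<lambda>x. (cmod (f x))\<^sup>2) summable_on UNIV}"
  morphisms ell2_coord Abs_ell2
  by (rule exI[of _ "\<lambda>_. 0"]) simp

setup_lifting type_definition_ell2

lemma ell2_coord_summable: "(\<lambda>x. (cmod (ell2_coord f x))\<^sup>2) summable_on UNIV"
  using ell2_coord[of f] by simp

lemma ell2_eqI: "(\<And>x. ell2_coord f x = ell2_coord g x) \<Longrightarrow> f = g"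
  by (simp add: ell2_coord_inject[symmetric] fun_eq_iff)

instantiation ell2 :: (type) complex_inner
begin

lift_definition zero_ell2 :: "'a ell2" is "\<lambda>_. 0" by simp

lift_definition plus_ell2 :: "'a ell2 \<Rightarrow> 'a ell2 \<Rightarrow> 'a ell2" is "\<lambda>f g x. f x + g x"
  by (rule square_summable_add)

lift_definition scaleC_ell2 :: "complex \<Rightarrow> 'a ell2 \<Rightarrow> 'a ell2" is "\<lambda>c f x. c * f x"
  by (rule square_summable_scale)

definition "scaleR r (f :: 'a ell2) = complex_of_real r *\<^sub>C f"

definition "- (f :: 'a ell2) = (- 1) *\<^sub>C f"

definition "(f :: 'a ell2) - g = f + - g"

definition "cinner (f :: 'a ell2) g = (\<Sum>\<^sub>\<infinity>x. ell2_coord f x * cnj (ell2_coord g x))"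

definition "inner (f :: 'a ell2) g = Re (cinner f g)"

definition "norm (f :: 'a ell2) = sqrt (inner f f)"

definition "sgn (f :: 'a ell2) = inverse (norm f) *\<^sub>R f"

definition "dist (f :: 'a ell2) g = norm (f - g)"

definition [code del]:
  "(uniformity :: ('a ell2 \<times> 'a ell2) filter) = (INF e\<in>{0 <..}. principal {(f, g). dist f g < e})"

definition [code del]:
  "open (U :: 'a ell2 set) \<longleftrightarrow>
    (\<forall>f\<in>U. eventually (\<lambda>(f', g). f' = f \<longrightarrow> g \<in> U) uniformity)"

lemma ell2_coord_simps:
  "ell2_coord 0 x = 0"
  "ell2_coord (f + g) x = ell2_coord f x + ell2_coord g x"
  "ell2_coord (c *\<^sub>C f) x = c * ell2_coord f x"
  "ell2_coord (r *\<^sub>R f) x = complex_of_real r * ell2_coord f x"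
  "ell2_coord (- f) x = - ell2_coord f x"
  "ell2_coord (f - g) x = ell2_coord f x - ell2_coord g x"
  by (simp_all add: zero_ell2.rep_eq plus_ell2.rep_eq scaleC_ell2.rep_eq scaleR_ell2_def
      uminus_ell2_def minus_ell2_def)

lemma inner_self_ell2: "inner f f = (\<Sum>\<^sub>\<infinity>x. (cmod (ell2_coord f x))\<^sup>2)" for f :: "'a ell2"
proof -
  have "inner f f = (\<Sum>\<^sub>\<infinity>x. Re (ell2_coord f x * cnj (ell2_coord f x)))"
    unfolding inner_ell2_def cinner_ell2_def
    by (intro infsum_Re[symmetric] square_summable_mult ell2_coord_summable)
  then show ?thesis by (simp add: complex_norm_square[symmetric])
qed

instance
proof
  fix f g h :: "'a ell2" and r s :: real and c d :: complex
  show "f + g + h = f + (g + h)" "f + g = g + f" "0 + f = f" "- f + f = 0" "f - g = f + - g"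
    "r *\<^sub>R (f + g) = r *\<^sub>R f + r *\<^sub>R g" "(r + s) *\<^sub>R f = r *\<^sub>R f + s *\<^sub>R f"
    "r *\<^sub>R s *\<^sub>R f = (r * s) *\<^sub>R f" "1 *\<^sub>R f = f"
    "c *\<^sub>C (f + g) = c *\<^sub>C f + c *\<^sub>C g" "(c + d) *\<^sub>C f = c *\<^sub>C f + d *\<^sub>C f"
    "c *\<^sub>C d *\<^sub>C f = (c * d) *\<^sub>C f" "r *\<^sub>R f = complex_of_real r *\<^sub>C f"
    by (rule ell2_eqI; simp add: ell2_coord_simps algebra_simps)+
  show "sgn f = inverse (norm f) *\<^sub>R f" by (simp add: sgn_ell2_def)
  show "dist f g = norm (f - g)" by (simp add: dist_ell2_def)
  show "(uniformity :: ('a ell2 \<times> 'a ell2) filter) =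
      (INF e\<in>{0 <..}. principal {(f, g). dist f g < e})"
    by (simp add: uniformity_ell2_def)
  show "open U \<longleftrightarrow> (\<forall>f\<in>U. eventually (\<lambda>(f', g). f' = f \<longrightarrow> g \<in> U) uniformity)"
    for U :: "'a ell2 set"
    by (simp add: open_ell2_def)
  show comm: "cinner f g = cnj (cinner g f)" for f g :: "'a ell2"
    unfolding cinner_ell2_def infsum_cnj[symmetric] by (simp add: mult.commute)
  show add: "cinner (f + g) h = cinner f h + cinner g h"
    unfolding cinner_ell2_def ell2_coord_simps distrib_right
    by (intro infsum_add square_summable_mult ell2_coord_summable)
  show scale: "cinner (c *\<^sub>C f) g = c * cinner f g" for c
    unfolding cinner_ell2_def ell2_coord_simps mult.assoc by (rule infsum_cmult_right')
  show "inner f g = Re (cinner f g)" by (simp add: inner_ell2_def)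
  show "inner f g = inner g f"
    using comm[of f g] by (simp add: inner_ell2_def)
  show "inner (f + g) h = inner f h + inner g h"
    by (simp add: inner_ell2_def add)
  show "inner (r *\<^sub>R f) g = r * inner f g"
    by (simp add: inner_ell2_def scaleR_ell2_def scale)
  show "0 \<le> inner f f"
    unfolding inner_self_ell2 by (rule infsum_nonneg) simp
  show "inner f f = 0 \<longleftrightarrow> f = 0"
  proof
    assume "inner f f = 0"
    then have le: "(\<Sum>\<^sub>\<infinity>x. (cmod (ell2_coord f x))\<^sup>2) \<le> 0" by (simp add: inner_self_ell2)
    have "(cmod (ell2_coord f x))\<^sup>2 = 0" for x
      by (rule nonneg_infsum_le_0D[OF le ell2_coord_summable]) auto
    then show "f = 0" by (intro ell2_eqI) (simp add: ell2_coord_simps)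
  qed (simp add: inner_self_ell2 ell2_coord_simps)
  show "norm f = sqrt (inner f f)" by (simp add: norm_ell2_def)
qed

end

lemma norm_ell2_square: "(norm f)\<^sup>2 = (\<Sum>\<^sub>\<infinity>x. (cmod (ell2_coord f x))\<^sup>2)" for f :: "'a ell2"
  by (simp add: power2_norm_eq_inner inner_self_ell2)

lemma sum_coord_le_norm_ell2:
  fixes f :: "'a ell2"
  assumes "finite F"
  shows "(\<Sum>x\<in>F. (cmod (ell2_coord f x))\<^sup>2) \<le> (norm f)\<^sup>2"
  unfolding norm_ell2_square by (rule finite_sum_le_infsum) (use assms ell2_coord_summable in auto)

lemma coord_le_norm_ell2: "cmod (ell2_coord f x) \<le> norm f"
  using sum_coord_le_norm_ell2[of "{x}" f] by (simp add: power2_le_iff_abs_le)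

instance ell2 :: (type) chilbert_space
proof
  fix X :: "nat \<Rightarrow> 'a ell2"
  assume X: "Cauchy X"
  have "Cauchy (\<lambda>m. ell2_coord (X m) x)" for x
  proof (rule metric_CauchyI)
    fix e :: real assume "e > 0"
    then obtain M where M: "\<And>m n. m \<ge> M \<Longrightarrow> n \<ge> M \<Longrightarrow> norm (X m - X n) < e"
      using X unfolding Cauchy_def dist_norm by metis
    have "dist (ell2_coord (X m) x) (ell2_coord (X n) x) < e" if "m \<ge> M" "n \<ge> M" for m n
      using coord_le_norm_ell2[of "X m - X n" x] M[OF that] by (simp add: dist_norm ell2_coord_simps)
    then show "\<exists>M. \<forall>m\<ge>M. \<forall>n\<ge>M. dist (ell2_coord (X m) x) (ell2_coord (X n) x) < e" by blast
  qed
  then have "\<forall>x. \<exists>l. (\<lambda>m. ell2_coord (X m) x) \<longlonglongrightarrow> l"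
    by (simp add: Cauchy_convergent_iff convergent_def)
  then obtain l where l: "\<And>x. (\<lambda>m. ell2_coord (X m) x) \<longlonglongrightarrow> l x" by metis
  have bound: "(\<Sum>x\<in>F. (cmod (l x - ell2_coord (X n) x))\<^sup>2) \<le> e\<^sup>2"
    if "\<And>m. m \<ge> M \<Longrightarrow> norm (X m - X n) \<le> e" "finite F" for F n M e
  proof (rule tendsto_upperbound)
    show "(\<lambda>m. \<Sum>x\<in>F. (cmod (ell2_coord (X m) x - ell2_coord (X n) x))\<^sup>2) \<longlonglongrightarrow>
      (\<Sum>x\<in>F. (cmod (l x - ell2_coord (X n) x))\<^sup>2)"
      by (intro tendsto_intros l)
    have "(\<Sum>x\<in>F. (cmod (ell2_coord (X m) x - ell2_coord (X n) x))\<^sup>2) \<le> e\<^sup>2" if "m \<ge> M" for m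
    proof -
      have "(\<Sum>x\<in>F. (cmod (ell2_coord (X m - X n) x))\<^sup>2) \<le> (norm (X m - X n))\<^sup>2"
        by (rule sum_coord_le_norm_ell2) fact
      also have "\<dots> \<le> e\<^sup>2"
        using \<open>\<And>m. m \<ge> M \<Longrightarrow> norm (X m - X n) \<le> e\<close>[OF that] by (intro power_mono) auto
      finally show ?thesis by (simp add: ell2_coord_simps)
    qed
    then show "\<forall>\<^sub>F m in sequentially.
        (\<Sum>x\<in>F. (cmod (ell2_coord (X m) x - ell2_coord (X n) x))\<^sup>2) \<le> e\<^sup>2"
      by (auto simp: eventually_sequentially)
  qed simp
  have diff: "(\<lambda>x. (cmod (l x - ell2_coord (X n) x))\<^sup>2) summable_on UNIV"
    if "\<And>m. m \<ge> M \<Longrightarrow> norm (X m - X n) \<le> e" for n M e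
    by (rule nonneg_bdd_above_summable_on) (auto intro!: bdd_aboveI bound that)
  obtain M1 where M1: "\<And>m. m \<ge> M1 \<Longrightarrow> norm (X m - X M1) \<le> 1"
    using X unfolding Cauchy_def dist_norm by (metis less_imp_le order_refl zero_less_one)
  have "(\<lambda>x. (cmod ((l x - ell2_coord (X M1) x) + ell2_coord (X M1) x))\<^sup>2) summable_on UNIV"
    by (rule square_summable_add[OF diff[OF M1] ell2_coord_summable])
  then have coordL: "ell2_coord (Abs_ell2 l) = l"
    by (intro Abs_ell2_inverse) simp
  have "X \<longlonglongrightarrow> Abs_ell2 l"
  proof (rule metric_LIMSEQ_I)
    fix e :: real assume "e > 0"
    then obtain M where M: "\<And>m n. m \<ge> M \<Longrightarrow> n \<ge> M \<Longrightarrow> norm (X m - X n) < e / 2"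
      using X unfolding Cauchy_def dist_norm by (metis half_gt_zero)
    have "dist (X n) (Abs_ell2 l) < e" if "n \<ge> M" for n
    proof -
      have le: "norm (X m - X n) \<le> e / 2" if "m \<ge> M" for m
        using M[OF that \<open>n \<ge> M\<close>] by simp
      have "(norm (Abs_ell2 l - X n))\<^sup>2 \<le> (e / 2)\<^sup>2"
        unfolding norm_ell2_square ell2_coord_simps coordL
        by (rule infsum_le_finite_sums[OF diff[OF le] bound[OF le]])
      then have "norm (Abs_ell2 l - X n) \<le> e / 2"
        using \<open>e > 0\<close> by (simp add: power2_le_iff_abs_le)
      then show ?thesis using \<open>e > 0\<close> by (simp add: dist_norm norm_minus_commute)
    qed
    then show "\<exists>M. \<forall>n\<ge>M. dist (X n) (Abs_ell2 l) < e" by blast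
  qed
  then show "convergent X" by (auto simp: convergent_def)
qed

lift_definition ell2_basis :: "'a \<Rightarrow> 'a ell2" is "\<lambda>a x. if x = a then 1 else 0"
proof -
  fix a :: 'a
  have "(\<lambda>x. (cmod (if x = a then 1 else 0))\<^sup>2) summable_on UNIV \<longleftrightarrow>
      (\<lambda>x. (cmod (if x = a then 1 else 0))\<^sup>2) summable_on {a}"
    by (rule summable_on_cong_neutral) auto
  then show "(\<lambda>x. (cmod (if x = a then 1 else 0))\<^sup>2) summable_on UNIV" by simp
qed

text \<open>The space of square-summable families indexed by the set \<open>A\<close>, as a closed subspace.\<close>

definition ell2_on :: "'a set \<Rightarrow> 'a ell2 set" where
  "ell2_on A = {f. \<forall>x. x \<notin> A \<longrightarrow> ell2_coord f x = 0}"


section \<open>The regular polyball and the standard tuple\<close>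

text \<open>Indices \<open>i\<close>, \<open>s\<close> range over \<open>{1..k}\<close>, \<open>{1..n i}\<close>. The word \<open>g\<^sub>p\<^sub>1 \<dots> g\<^sub>p\<^sub>m\<close> of the \<open>i\<close>-th
  free semigroup is the list \<open>[p1, \<dots>, pm]\<close>, and \<open>lam i j s t\<close> is the entry \<open>(s, t)\<close> of the
  matrix with index \<open>(i, j)\<close>.\<close>

type_synonym multiword = "nat \<Rightarrow> nat list"
type_synonym 'a tuple = "nat \<Rightarrow> nat \<Rightarrow> 'a \<Rightarrow> 'a"

definition multiwords :: "nat \<Rightarrow> (nat \<Rightarrow> nat) \<Rightarrow> multiword set" where
  "multiwords k n = (\<Pi>\<^sub>E i\<in>{1..k}. lists {1..n i})"

definition twist :: "nat \<Rightarrow> (nat \<Rightarrow> nat) \<Rightarrow> (nat \<Rightarrow> nat \<Rightarrow> nat \<Rightarrow> nat \<Rightarrow> complex) \<Rightarrow> bool" where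
  "twist k n lam \<longleftrightarrow>
    (\<forall>i\<in>{1..k}. \<forall>j\<in>{1..k}. i \<noteq> j \<longrightarrow> (\<forall>s\<in>{1..n i}. \<forall>t\<in>{1..n j}.
      cmod (lam i j s t) = 1 \<and> lam j i t s = cnj (lam i j s t)))"

text \<open>The map \<open>X \<mapsto> \<Sum>\<^sub>s r\<^sup>2 T\<^sub>s X T\<^sub>s\<^sup>*\<close>, for a row \<open>R = [T\<^sub>1 \<dots> T\<^sub>m]\<close>.\<close>

definition row_map ::
  "real \<Rightarrow> nat \<Rightarrow> (nat \<Rightarrow> 'a::complex_inner \<Rightarrow> 'a) \<Rightarrow> ('a \<Rightarrow> 'a) \<Rightarrow> 'a \<Rightarrow> 'a" where
  "row_map r m R X x = (\<Sum>s\<in>{1..m}. r\<^sup>2 *\<^sub>R R s (X (cadjoint (R s) x)))"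

definition regular_polyball ::
  "nat \<Rightarrow> (nat \<Rightarrow> nat) \<Rightarrow> (nat \<Rightarrow> nat \<Rightarrow> nat \<Rightarrow> nat \<Rightarrow> complex) \<Rightarrow> 'a::chilbert_space tuple set" where
  "regular_polyball k n lam = {T.
    (\<forall>i\<in>{1..k}. \<forall>s\<in>{1..n i}. bounded_clinear (T i s)) \<and>
    (\<forall>i\<in>{1..k}. positive_op (\<lambda>x. x - (\<Sum>s\<in>{1..n i}. T i s (cadjoint (T i s) x)))) \<and>
    (\<forall>i\<in>{1..k}. \<forall>j\<in>{1..k}. i \<noteq> j \<longrightarrow> (\<forall>s\<in>{1..n i}. \<forall>t\<in>{1..n j}. \<forall>x.
      T i s (T j t x) = lam i j s t *\<^sub>C T j t (T i s x))) \<and>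
    (\<forall>r\<in>{0..<1}. positive_op
      (foldr (\<lambda>i X x. X x - row_map r (n i) (T i) X x) [1..<Suc k] (\<lambda>x. x)))}"

text \<open>The sum over all multiwords is the linear and continuous extension of the prescription on
  the basis; see the lemma below.\<close>

definition standard_tuple ::
  "nat \<Rightarrow> (nat \<Rightarrow> nat) \<Rightarrow> (nat \<Rightarrow> nat \<Rightarrow> nat \<Rightarrow> nat \<Rightarrow> complex) \<Rightarrow> multiword ell2 tuple" where
  "standard_tuple k n lam i s f = (\<Sum>\<^sub>\<infinity>\<alpha>\<in>multiwords k n. ell2_coord f \<alpha> *\<^sub>C
     ((\<Prod>j\<in>{1..<i}. prod_list (map (lam i j s) (\<alpha> j))) *\<^sub>C ell2_basis (\<alpha>(i := s # \<alpha> i))))"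

lemma standard_tuple_basis:
  assumes "\<alpha> \<in> multiwords k n"
  shows "standard_tuple k n lam i s (ell2_basis \<alpha>) =
    (\<Prod>j\<in>{1..<i}. prod_list (map (lam i j s) (\<alpha> j))) *\<^sub>C ell2_basis (\<alpha>(i := s # \<alpha> i))"
    (is "_ = ?b \<alpha>")
proof -
  have "standard_tuple k n lam i s (ell2_basis \<alpha>) =
      (\<Sum>\<^sub>\<infinity>\<beta>\<in>{\<alpha>}. ell2_coord (ell2_basis \<alpha>) \<beta> *\<^sub>C ?b \<beta>)"
    unfolding standard_tuple_def
    by (rule infsum_cong_neutral)
      (use assms in \<open>auto intro!: ell2_eqI simp: ell2_coord_simps ell2_basis.rep_eq simp del: fun_upd_apply\<close>)
  also have "\<dots> = ?b \<alpha>"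
    by (rule ell2_eqI) (simp add: ell2_coord_simps ell2_basis.rep_eq del: fun_upd_apply)
  finally show ?thesis .
qed

definition word_op :: "(nat \<Rightarrow> 'a \<Rightarrow> 'a) \<Rightarrow> nat list \<Rightarrow> 'a \<Rightarrow> 'a" where
  "word_op R w = foldr (\<lambda>s A. R s \<circ> A) w id"

text \<open>The operator \<open>\<Sum> a(\<alpha>,\<beta>) T\<^sub>1\<^sub>,\<^sub>\<alpha>\<^sub>1 \<dots> T\<^sub>k\<^sub>,\<^sub>\<alpha>\<^sub>k T\<^sub>1\<^sub>,\<^sub>\<beta>\<^sub>1\<^sup>* \<dots> T\<^sub>k\<^sub>,\<^sub>\<beta>\<^sub>k\<^sup>*\<close>, summed over \<open>(\<alpha>, \<beta>) \<in> F\<close>, on the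
  Hilbert space \<open>V\<close>.\<close>

definition poly_op ::
  "'a::complex_inner set \<Rightarrow> nat \<Rightarrow> (multiword \<times> multiword) set \<Rightarrow>
   (multiword \<Rightarrow> multiword \<Rightarrow> complex) \<Rightarrow> 'a tuple \<Rightarrow> 'a \<Rightarrow> 'a" where
  "poly_op V k F a T x = (\<Sum>(\<alpha>, \<beta>)\<in>F. a \<alpha> \<beta> *\<^sub>C
     (foldr (\<lambda>i A. word_op (T i) (\<alpha> i) \<circ> A) [1..<Suc k] id
       (foldr (\<lambda>i A. cadjoint_on V (word_op (T i) (\<beta> i)) \<circ> A) [1..<Suc k] id x)))"

end

theory Submission
  imports Defs
begin

text \<open>
  For \<open>r < 1\<close> put \<open>C\<^sub>i\<^sub>,\<^sub>s = r T\<^sub>i\<^sub>,\<^sub>s\<^sup>*\<close> and let \<open>\<Delta>\<close> be the positive form of the defect operator of \<open>r T\<close>.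
  The Poisson kernel \<open>h \<mapsto> (C\<^sub>\<gamma> h)\<^sub>\<gamma>\<close>, where \<open>C\<^sub>\<gamma> = (r\<^bsup>|\<gamma>|\<^esup> T\<^sub>1\<^sub>,\<^sub>\<gamma>\<^sub>1 \<dots> T\<^sub>k\<^sub>,\<^sub>\<gamma>\<^sub>k)\<^sup>*\<close>, intertwines each
  \<open>C\<^sub>i\<^sub>,\<^sub>s\<close> with \<open>S\<^sub>i\<^sub>,\<^sub>s\<^sup>*\<close>, and it is isometric for \<open>\<Delta>\<close>: since the maps \<open>\<Phi>\<^sub>i\<close> commute, the sum of
  \<open>\<Delta> (C\<^sub>\<gamma> x, C\<^sub>\<gamma> y)\<close> over a box of multiwords telescopes to \<open>\<Prod>\<^sub>i (id - \<Phi>\<^sub>i\<^bsup>M\<^sub>i\<^esup>)\<close>, which tends to the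
  identity. Tensor products and square roots are avoided by truncating the kernel to a box:
  finitely many vectors are involved, on which \<open>\<Delta>\<close> is a finite sum of rank-one forms, and each
  of these gives a vector of \<open>\<ell>\<^sup>2\<close> to which the bound for \<open>p(S, S\<^sup>*)\<close> applies. Boxes
  growing to all multiwords and then \<open>r \<rightarrow> 1\<close> give the inequality.
\<close>

section \<open>Hermitian forms\<close>

text \<open>An operator X is represented below by its form (x, y) \<mapsto> <X x, y>. Conjugating X
  by operators then becomes substitution into both arguments of the form. Positivity is a separate
  assumption where it enters, so that the class is closed under differences.\<close>

definition hermitian_form :: "('a::complex_inner \<Rightarrow> 'a \<Rightarrow> complex) \<Rightarrow> bool" where
  "hermitian_form B \<longleftrightarrow> (\<forall>x y z. B (x + y) z = B x z + B y z) \<and>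
     (\<forall>c x y. B (c *\<^sub>C x) y = c * B x y) \<and> (\<forall>x y. B y x = cnj (B x y))"

lemma hermitian_formD:
  assumes "hermitian_form B"
  shows "B (x + y) z = B x z + B y z" "B (c *\<^sub>C x) y = c * B x y"
    and "B z (x + y) = B z x + B z y" "B x (c *\<^sub>C y) = cnj c * B x y"
proof -
  note * = assms[unfolded hermitian_form_def]
  show left: "B (x + y) z = B x z + B y z" "B (c *\<^sub>C x) y = c * B x y" for x y z c using * by blast+
  have comm: "B u v = cnj (B v u)" for u v using * by blast
  show "B z (x + y) = B z x + B z y" "B x (c *\<^sub>C y) = cnj c * B x y"
    using comm[of z "x + y"] comm[of x "c *\<^sub>C y"] comm[of z x] comm[of z y] comm[of x y]
    by (simp_all add: left)
qed

lemma hermitian_form_commute: "hermitian_form B \<Longrightarrow> B y x = cnj (B x y)"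
  unfolding hermitian_form_def by blast

lemma hermitian_form_self: "hermitian_form B \<Longrightarrow> B x x = of_real (Re (B x x))"
  using hermitian_form_commute[of B x x] by (simp add: complex_eq_iff)

lemma hermitian_form_cinner: "hermitian_form cinner"
  unfolding hermitian_form_def using cinner_add_left cinner_scaleC_left cinner_commute by blast

lemmas cinner_add_right = hermitian_formD(3)[OF hermitian_form_cinner]
  and cinner_scaleC_right = hermitian_formD(4)[OF hermitian_form_cinner]

lemma scaleC_one [simp]: "1 *\<^sub>C x = x" for x :: "'a::complex_inner"
  using scaleR_scaleC[of 1 x] by simp

lemma cinner_zero_left [simp]: "cinner 0 y = 0" and cinner_zero_right [simp]: "cinner y 0 = 0"
  using cinner_add_left[of 0 0 y] cinner_add_right[of y 0 0] by simp_all

lemma cinner_diff_left: "cinner (x - y) z = cinner x z - cinner y z"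
  and cinner_diff_right: "cinner z (x - y) = cinner z x - cinner z y"
  using cinner_add_left[of "x - y" y z] cinner_add_right[of z "x - y" y] by simp_all

lemma cinner_sum_left: "cinner (sum f A) y = (\<Sum>i\<in>A. cinner (f i) y)"
  by (induction A rule: infinite_finite_induct) (auto simp: cinner_add_left)

lemma cinner_self: "cinner x x = of_real ((norm x)\<^sup>2)"
  using hermitian_form_self[OF hermitian_form_cinner, of x]
  by (simp add: power2_norm_eq_inner inner_eq_Re_cinner)

text \<open>The norm stems from the real inner product, so complex homogeneity is derived from <c x,
  c x> = |c|^2 <x, x>.\<close>

lemma norm_scaleC: "norm (c *\<^sub>C x) = cmod c * norm x" for x :: "'a::complex_inner"
proof -
  have "complex_of_real ((norm (c *\<^sub>C x))\<^sup>2) = of_real ((cmod c * norm x)\<^sup>2)"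
    unfolding cinner_self[symmetric] cinner_scaleC_left cinner_scaleC_right
    unfolding mult.assoc[symmetric] cinner_self power_mult_distrib of_real_mult complex_norm_square[of c]
    by (simp add: mult.commute)
  then show ?thesis by (simp only: of_real_eq_iff) (simp add: power2_eq_iff_nonneg)
qed

text \<open>Evaluating the form at x - t B(x, y) y, for real t, gives the nonnegative quadratic
  \<open>quad\<close> in t. Definiteness is not assumed, so an isotropic y is a separate
  case.\<close>

lemma hermitian_form_Cauchy_Schwarz:
  assumes B: "hermitian_form B" and nonneg: "\<And>x. 0 \<le> Re (B x x)"
  shows "(cmod (B x y))\<^sup>2 \<le> Re (B x x) * Re (B y y)"
proof -
  define b p q where "b = (cmod (B x y))\<^sup>2" and "p = Re (B x x)" and "q = Re (B y y)"
  have quad: "0 \<le> p - 2 * t * b + t\<^sup>2 * b * q" for t :: real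
  proof -
    define d where "d = - (of_real t * B x y)"
    have bb: "B x y * cnj (B x y) = of_real b"
      unfolding b_def by (rule complex_norm_square[symmetric])
    have "B (x + d *\<^sub>C y) (x + d *\<^sub>C y) = B x x + cnj d * B x y + d * cnj (B x y) + d * cnj d * B y y"
      by (simp add: hermitian_formD[OF B] hermitian_form_commute[OF B, of x y] algebra_simps)
    also have "\<dots> = of_real p - 2 * of_real t * of_real b + (of_real t)\<^sup>2 * of_real b * of_real q"
      unfolding bb[symmetric] d_def p_def q_def hermitian_form_self[OF B, of x, symmetric]
        hermitian_form_self[OF B, of y, symmetric]
      by (simp add: algebra_simps power2_eq_square)
    also have "\<dots> = of_real (p - 2 * t * b + t\<^sup>2 * b * q)" by simp
    finally show ?thesis using nonneg[of "x + d *\<^sub>C y"] by (simp only: Re_complex_of_real)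
  qed
  have "p \<ge> 0" "q \<ge> 0" "b \<ge> 0" using nonneg by (auto simp: p_def q_def b_def)
  have "b \<le> p * q"
  proof (cases "q = 0")
    case True
    \<comment> \<open>For q = 0 the quadratic is affine in t; if b were positive, this t would give
      it the value -1.\<close>
    then show ?thesis
      using quad[of "(p + 1) / (2 * b)"] \<open>b \<ge> 0\<close> by (cases "b = 0") auto
  next
    case False
    then have "q > 0" using \<open>q \<ge> 0\<close> by simp
    then show ?thesis using quad[of "1 / q"] by (simp add: field_simps power2_eq_square)
  qed
  then show ?thesis by (simp add: b_def p_def q_def)
qed

lemma cmod_cinner_le: "cmod (cinner x y) \<le> norm x * norm y"
proof -
  have "(cmod (cinner x y))\<^sup>2 \<le> (norm x * norm y)\<^sup>2"
    using hermitian_form_Cauchy_Schwarz[OF hermitian_form_cinner, of x y]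
    by (simp add: cinner_self power_mult_distrib)
  then show ?thesis by (rule power2_le_imp_le) simp
qed

text \<open>Cholesky factorisation: one vector is split off by subtracting the rank-one form that it
  carries. If that vector is isotropic then, division by zero being zero, nothing is subtracted.\<close>

lemma hermitian_form_factor:
  assumes "finite X" "hermitian_form B" "\<And>x. 0 \<le> Re (B x x)"
  shows "\<exists>(m::nat) c. \<forall>x\<in>X. \<forall>y\<in>X. B x y = (\<Sum>l<m. c l x * cnj (c l y))"
  using assms
proof (induction X arbitrary: B rule: finite_induct)
  case empty
  then show ?case by simp
next
  case (insert a X)
  note B = \<open>hermitian_form B\<close>
  define p where "p = Re (B a a)"
  have Baa: "B a a = of_real p" using hermitian_form_self[OF B] by (simp add: p_def)
  have p: "p \<ge> 0" using insert.prems(2) by (simp add: p_def)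
  define B' where "B' = (\<lambda>x y. B x y - B x a * B a y / of_real p)"
  have BaC: "B a y = cnj (B y a)" for y by (rule hermitian_form_commute[OF B])
  have "hermitian_form B'"
    unfolding hermitian_form_def
  proof (intro conjI allI)
    show "B' (x + y) z = B' x z + B' y z" "B' (c *\<^sub>C x) y = c * B' x y" for x y z c
      by (simp_all add: B'_def hermitian_formD[OF B] add_divide_distrib algebra_simps)
    show "B' y x = cnj (B' x y)" for x y
      using hermitian_form_commute[OF B, of x y] BaC[of x] BaC[of y] by (simp add: B'_def)
  qed
  moreover have "0 \<le> Re (B' x x)" for x
  proof -
    have "B x a * B a x = of_real ((cmod (B x a))\<^sup>2)" unfolding BaC[of x] by (rule complex_norm_square[symmetric])
    then have "B' x x = of_real (Re (B x x) - (cmod (B x a))\<^sup>2 / p)"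
      using hermitian_form_self[OF B, of x] by (simp add: B'_def)
    moreover have "(cmod (B x a))\<^sup>2 / p \<le> Re (B x x)"
      using hermitian_form_Cauchy_Schwarz[OF B insert.prems(2), of x a] p insert.prems(2)[of x]
      by (cases "p = 0") (auto simp: p_def field_simps)
    ultimately show ?thesis by simp
  qed
  ultimately obtain m :: nat and c where
    c: "\<And>x y. x \<in> X \<Longrightarrow> y \<in> X \<Longrightarrow> B' x y = (\<Sum>l<m. c l x * cnj (c l y))"
    using insert.IH[of B'] by blast
  \<comment> \<open>The subtraction puts \<open>a\<close> into the radical of \<open>B'\<close>. If
    \<open>p = 0\<close>, Cauchy-Schwarz already puts \<open>a\<close> into the radical of
    \<open>B\<close>.\<close>
  have B'a: "B' a y = 0" for y
    using hermitian_form_Cauchy_Schwarz[OF B insert.prems(2), of a y]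
    by (cases "p = 0") (auto simp: B'_def Baa)
  have B'a': "B' y a = 0" for y
    using B'a[of y] hermitian_form_commute[OF \<open>hermitian_form B'\<close>, of a y] by simp
  \<comment> \<open>The induction hypothesis controls \<open>c l\<close> only on \<open>X\<close>,
    so its value at \<open>a\<close> is reset to 0, in accordance with \<open>B'\<close> vanishing
    there. Index m carries the rank-one form that was split off.\<close>
  define c' where "c' l x = (if l < m then if x = a then 0 else c l x else B x a / of_real (sqrt p))"
    for l x
  have "B x y = (\<Sum>l<Suc m. c' l x * cnj (c' l y))" if "x \<in> insert a X" "y \<in> insert a X" for x y
  proof -
    have "(\<Sum>l<m. c' l x * cnj (c' l y)) = B' x y"
      using that c insert.hyps(2) by (auto simp: c'_def B'a B'a' intro!: sum.cong)
    moreover have "c' m x * cnj (c' m y) = B x a * B a y / of_real p"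
      using p by (simp add: c'_def BaC[of y] flip: of_real_mult)
    ultimately show ?thesis by (simp add: B'_def)
  qed
  then show ?case by blast
qed

section \<open>Adjoints\<close>

text \<open>The representing vector minimises \<open>(norm x)\<^sup>2 - 2 * f x\<close>.\<close>

lemma Riesz_representation_real:
  fixes f :: "'a::{real_inner, complete_space} \<Rightarrow> real"
  assumes "bounded_linear f"
  shows "\<exists>z. \<forall>x. f x = inner x z"
proof -
  interpret bounded_linear f by fact
  define J where "J x = (norm x)\<^sup>2 - 2 * f x" for x
  obtain K where K: "\<And>x. norm (f x) \<le> norm x * K" using bounded by blast
  \<comment> \<open>Completing the square in |x|^2 - 2 K |x| bounds \<open>J\<close> from
    below.\<close>
  have low: "J x \<ge> - K\<^sup>2" for x
  proof -
    have "f x \<le> norm x * K" using K[of x] by simp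
    moreover have "0 \<le> (norm x - K)\<^sup>2" by simp
    ultimately show ?thesis by (simp add: J_def power2_eq_square algebra_simps)
  qed
  define \<mu> where "\<mu> = (INF x. J x)"
  have bdd: "bdd_below (range J)" using low by (auto intro!: bdd_belowI)
  have \<mu>: "\<mu> \<le> J x" for x unfolding \<mu>_def by (rule cINF_lower[OF bdd]) simp
  have "\<exists>x. J x < \<mu> + inverse (real (Suc m))" for m
    using cINF_less_iff[OF _ bdd, of "\<mu> + inverse (real (Suc m))"] by (auto simp: \<mu>_def)
  then obtain X where X: "\<And>m. J (X m) < \<mu> + inverse (real (Suc m))" by metis
  \<comment> \<open>By the parallelogram law; the linear terms cancel. As \<open>J\<close> at the
    midpoint is at least \<mu>, two near-minimisers are close to each other.\<close>
  have par: "(norm (x - y))\<^sup>2 = 2 * J x + 2 * J y - 4 * J ((1/2) *\<^sub>R (x + y))" for x y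
    by (simp add: J_def power2_norm_eq_inner scaleR add algebra_simps inner_commute)
  have "Cauchy X"
  proof (rule metric_CauchyI)
    fix e :: real assume e: "e > 0"
    obtain M where M: "inverse (real (Suc M)) < e\<^sup>2 / 4"
      using reals_Archimedean[of "e\<^sup>2 / 4"] e by auto
    have "dist (X m) (X m') < e" if "m \<ge> M" "m' \<ge> M" for m m'
    proof -
      have "inverse (real (Suc m)) \<le> inverse (real (Suc M))" "inverse (real (Suc m')) \<le> inverse (real (Suc M))"
        using that by (auto intro!: le_imp_inverse_le)
      then have "(norm (X m - X m'))\<^sup>2 < e\<^sup>2"
        using par[of "X m" "X m'"] X[of m] X[of m'] \<mu>[of "(1/2) *\<^sub>R (X m + X m')"] M by linarith
      then show ?thesis using e by (simp add: dist_norm power2_less_imp_less)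
    qed
    then show "\<exists>M. \<forall>m\<ge>M. \<forall>n\<ge>M. dist (X m) (X n) < e" by blast
  qed
  then obtain z where z: "X \<longlonglongrightarrow> z" using Cauchy_convergent_iff convergent_def by blast
  have "(\<lambda>m. J (X m)) \<longlonglongrightarrow> J z"
    unfolding J_def by (intro tendsto_intros tendsto z)
  moreover have "(\<lambda>m. \<mu> + inverse (real (Suc m))) \<longlonglongrightarrow> \<mu> + 0"
    by (intro tendsto_intros LIMSEQ_inverse_real_of_nat)
  ultimately have Jz: "J z \<le> \<mu>"
    using LIMSEQ_le[of "\<lambda>m. J (X m)" "J z" "\<lambda>m. \<mu> + inverse (real (Suc m))" "\<mu>"] X
    by (auto intro: less_imp_le)
  have "f x = inner x z" for x
  proof (cases "x = 0")
    case True
    then show ?thesis by (simp add: zero)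
  next
    case False
    define d where "d = f x - inner x z"
    \<comment> \<open>This t minimises the quadratic J(z + t x), so minimality of z forces d =
      0.\<close>
    define t where "t = d / (norm x)\<^sup>2"
    have "J z \<le> J (z + t *\<^sub>R x)" using Jz \<mu> order_trans by blast
    also have "\<dots> = J z + t\<^sup>2 * (norm x)\<^sup>2 - 2 * t * d"
      unfolding J_def d_def power2_norm_eq_inner
      by (simp add: add scaleR inner_commute algebra_simps power2_eq_square)
    also have "\<dots> = J z - d\<^sup>2 / (norm x)\<^sup>2"
      using False by (simp add: t_def field_simps power2_eq_square)
    finally have "d\<^sup>2 / (norm x)\<^sup>2 \<le> 0" by simp
    then have "d = 0" using False by (simp add: divide_le_0_iff)
    then show ?thesis by (simp add: d_def)
  qed
  then show ?thesis by blast
qed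

lemma cinner_eqI: "(\<And>x. cinner x y = cinner x z) \<Longrightarrow> y = z"
proof -
  assume "\<And>x. cinner x y = cinner x z"
  then have "cinner (y - z) (y - z) = 0" by (simp add: cinner_diff_right)
  then show "y = z" by (simp add: cinner_self)
qed

text \<open>The real Riesz theorem is applied to the real part of <A x, y>; the imaginary parts
  agree because x may be replaced by i x. The bound on B comes from |B y|^2 = <A (B y), y>.\<close>

lemma adjoint_exists:
  fixes A :: "'a::chilbert_space \<Rightarrow> 'a"
  assumes A: "bounded_clinear A"
  shows "\<exists>B. bounded_clinear B \<and> (\<forall>x y. cinner (A x) y = cinner x (B y))"
proof -
  have A': "bounded_linear A" "\<And>c x. A (c *\<^sub>C x) = c *\<^sub>C A x"
    using A by (auto simp: bounded_clinear_def)
  have "\<exists>z. \<forall>x. cinner (A x) y = cinner x z" for y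
  proof -
    have "bounded_linear (\<lambda>x. inner (A x) y)"
      by (rule bounded_linear_compose[OF bounded_linear_inner_left A'(1)])
    then obtain z where z: "\<And>x. inner (A x) y = inner x z"
      using Riesz_representation_real by blast
    have "cinner (A x) y = cinner x z" for x
    proof (rule complex_eqI)
      show "Re (cinner (A x) y) = Re (cinner x z)" using z[of x] by (simp add: inner_eq_Re_cinner)
      show "Im (cinner (A x) y) = Im (cinner x z)"
        using z[of "\<i> *\<^sub>C x"] by (simp add: A'(2) inner_eq_Re_cinner cinner_scaleC_left)
    qed
    then show ?thesis by blast
  qed
  then obtain B where B: "\<And>x y. cinner (A x) y = cinner x (B y)" by metis
  obtain K where K: "\<And>x. norm (A x) \<le> norm x * K" using A'(1) bounded_linear.bounded by blast
  have "norm (B y) \<le> norm y * K" for y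
  proof (cases "B y = 0")
    case True
    then show ?thesis
      using order_trans[OF norm_ge_zero K[of y]] by simp
  next
    case False
    have "(norm (B y))\<^sup>2 = cmod (cinner (A (B y)) y)" by (simp add: B cinner_self norm_power)
    also have "\<dots> \<le> norm (B y) * K * norm y"
      by (rule order_trans[OF cmod_cinner_le]) (simp add: K mult_right_mono)
    finally show ?thesis using False by (simp add: power2_eq_square mult_ac)
  qed
  moreover have "B (x + y) = B x + B y" "B (c *\<^sub>C x) = c *\<^sub>C B x" for x y c
    by (rule cinner_eqI; simp add: cinner_add_right cinner_scaleC_right B[symmetric])+
  ultimately have "bounded_clinear B"
    unfolding bounded_clinear_def
    by (auto intro!: bounded_linear_intro simp: scaleR_scaleC)
  with B show ?thesis by blast
qed

text \<open>Adjointness as a relation between two given maps, both preserving V. It composes easily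
  and says nothing about values off V; the description operator in \<open>cadjoint_on\<close> is
  resolved from it once and for all.\<close>

definition adjoint_pair :: "'a::complex_inner set \<Rightarrow> ('a \<Rightarrow> 'a) \<Rightarrow> ('a \<Rightarrow> 'a) \<Rightarrow> bool" where
  "adjoint_pair V A B \<longleftrightarrow> A ` V \<subseteq> V \<and> B ` V \<subseteq> V \<and> (\<forall>x\<in>V. \<forall>y\<in>V. cinner (A x) y = cinner x (B y))"

lemma adjoint_pair_id: "adjoint_pair V id id"
  by (simp add: adjoint_pair_def)

lemma adjoint_pair_comp:
  "adjoint_pair V A B \<Longrightarrow> adjoint_pair V A' B' \<Longrightarrow> adjoint_pair V (A \<circ> A') (B' \<circ> B)"
  unfolding adjoint_pair_def by (auto simp: image_subset_iff)

lemma adjoint_pair_foldr: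
  "(\<And>i. i \<in> set l \<Longrightarrow> adjoint_pair V (A i) (B i)) \<Longrightarrow> adjoint_pair V (foldr A l) (fold B l)"
proof (induction l)
  case Nil
  then show ?case by (simp add: adjoint_pair_id[unfolded id_def] id_def)
next
  case (Cons i l)
  then have "adjoint_pair V (A i \<circ> foldr A l) (fold B l \<circ> B i)"
    by (intro adjoint_pair_comp) auto
  then show ?case by (simp add: comp_def)
qed

text \<open>Uniqueness: the difference of two candidates lies in V and is orthogonal to
  itself.\<close>

lemma cadjoint_on_eq:
  assumes AB: "adjoint_pair V A B" and y: "y \<in> V"
    and V: "\<And>x y. x \<in> V \<Longrightarrow> y \<in> V \<Longrightarrow> x - y \<in> V"
  shows "cadjoint_on V A y = B y"
  unfolding cadjoint_on_def
proof (rule the_equality)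
  show "B y \<in> V \<and> (\<forall>x\<in>V. cinner (A x) y = cinner x (B y))"
    using AB y by (auto simp: adjoint_pair_def)
  fix z assume z: "z \<in> V \<and> (\<forall>x\<in>V. cinner (A x) y = cinner x z)"
  then have "z - B y \<in> V" using AB y V by (auto simp: adjoint_pair_def)
  then have "cinner (z - B y) z = cinner (z - B y) (B y)"
    using z AB y by (auto simp: adjoint_pair_def)
  then have "cinner (z - B y) (z - B y) = 0" by (simp add: cinner_diff_right)
  then show "z = B y" by (simp add: cinner_self)
qed

section \<open>Words and polynomials as iterated products\<close>

lemma word_op_eq_foldr: "word_op R w = foldr R w"
  unfolding word_op_def by (induction w) (auto simp: fun_eq_iff)

lemma foldr_comp_eq: "foldr (\<lambda>i A. f i \<circ> A) l id = foldr f l"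
  by (induction l) (auto simp: fun_eq_iff)

text \<open>Since \<open>fold\<close> applies the first letter first, \<open>fold Ts w\<close> is the adjoint of \<open>word_op T w\<close>
  when each \<open>Ts s\<close> is the adjoint of \<open>T s\<close>.\<close>

lemma multiword_letter: "\<alpha> \<in> multiwords k n \<Longrightarrow> i \<in> {1..k} \<Longrightarrow> s \<in> set (\<alpha> i) \<Longrightarrow> s \<in> {1..n i}"
  unfolding multiwords_def by (drule (1) PiE_mem) blast

lemma poly_op_eq:
  fixes V :: "'a::complex_inner set"
  assumes adj: "\<And>i s. i \<in> {1..k} \<Longrightarrow> s \<in> {1..n i} \<Longrightarrow> adjoint_pair V (T i s) (Ts i s)"
    and V: "\<And>x y. x \<in> V \<Longrightarrow> y \<in> V \<Longrightarrow> x - y \<in> V"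
    and F: "F \<subseteq> multiwords k n \<times> multiwords k n" and x: "x \<in> V"
  shows "poly_op V k F a T x = (\<Sum>(\<alpha>, \<beta>)\<in>F. a \<alpha> \<beta> *\<^sub>C
     foldr (\<lambda>i. foldr (T i) (\<alpha> i)) [1..<Suc k] (foldr (\<lambda>i. fold (Ts i) (\<beta> i)) [1..<Suc k] x))"
proof -
  \<comment> \<open>The second conjunct keeps the intermediate vectors in V, where the next
    \<open>cadjoint_on\<close> is known.\<close>
  have *: "foldr (\<lambda>i. cadjoint_on V (foldr (T i) (\<beta> i))) l x = foldr (\<lambda>i. fold (Ts i) (\<beta> i)) l x \<and>
      foldr (\<lambda>i. fold (Ts i) (\<beta> i)) l x \<in> V"
    if \<beta>: "\<beta> \<in> multiwords k n" and "set l \<subseteq> {1..k}" for \<beta> l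
    using that(2)
  proof (induction l)
    case (Cons i l)
    have "adjoint_pair V (foldr (T i) (\<beta> i)) (fold (Ts i) (\<beta> i))"
      by (rule adjoint_pair_foldr, rule adj) (use Cons.prems multiword_letter[OF \<beta>] in auto)
    moreover from this have "fold (Ts i) (\<beta> i) z \<in> V" if "z \<in> V" for z
      using that unfolding adjoint_pair_def by blast
    moreover have "foldr (\<lambda>i. cadjoint_on V (foldr (T i) (\<beta> i))) l x = foldr (\<lambda>i. fold (Ts i) (\<beta> i)) l x"
      "foldr (\<lambda>i. fold (Ts i) (\<beta> i)) l x \<in> V"
      using Cons by simp_all
    ultimately show ?case using cadjoint_on_eq[OF _ _ V] by simp
  qed (use x in simp)
  have "(case p of (\<alpha>, \<beta>) \<Rightarrow> a \<alpha> \<beta> *\<^sub>C foldr (\<lambda>i. foldr (T i) (\<alpha> i)) [1..<Suc k]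
      (foldr (\<lambda>i. cadjoint_on V (foldr (T i) (\<beta> i))) [1..<Suc k] x)) =
    (case p of (\<alpha>, \<beta>) \<Rightarrow> a \<alpha> \<beta> *\<^sub>C foldr (\<lambda>i. foldr (T i) (\<alpha> i)) [1..<Suc k]
      (foldr (\<lambda>i. fold (Ts i) (\<beta> i)) [1..<Suc k] x))" if "p \<in> F" for p
  proof -
    obtain \<alpha> \<beta> where p: "p = (\<alpha>, \<beta>)" by (cases p)
    then have "\<beta> \<in> multiwords k n" using that F by blast
    moreover have "set [1..<Suc k] \<subseteq> {1..k}" by auto
    ultimately have "foldr (\<lambda>i. cadjoint_on V (foldr (T i) (\<beta> i))) [1..<Suc k] x =
        foldr (\<lambda>i. fold (Ts i) (\<beta> i)) [1..<Suc k] x"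
      using * by blast
    then show ?thesis unfolding p by (simp del: upt_Suc)
  qed
  then show ?thesis
    unfolding poly_op_def foldr_comp_eq word_op_eq_foldr by (rule sum.cong[OF refl])
qed

lemma adjoint_pair_multiword:
  assumes adj: "\<And>i s. i \<in> {1..k} \<Longrightarrow> s \<in> {1..n i} \<Longrightarrow> adjoint_pair V (T i s) (Ts i s)"
    and \<alpha>: "\<alpha> \<in> multiwords k n"
  shows "adjoint_pair V (foldr (\<lambda>i. foldr (T i) (\<alpha> i)) [1..<Suc k]) (fold (\<lambda>i. fold (Ts i) (\<alpha> i)) [1..<Suc k])"
proof (rule adjoint_pair_foldr, rule adjoint_pair_foldr)
  fix i s assume "i \<in> set [1..<Suc k]" "s \<in> set (\<alpha> i)"
  then show "adjoint_pair V (T i s) (Ts i s)"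
    by (intro adj multiword_letter[OF \<alpha>]) auto
qed

lemma foldr_in: "(\<And>i x. i \<in> set l \<Longrightarrow> x \<in> V \<Longrightarrow> A i x \<in> V) \<Longrightarrow> x \<in> V \<Longrightarrow> foldr A l x \<in> V"
  by (induction l) auto

text \<open>The operators T_\<alpha> move to the other side of the inner product. What remains
  involves only adjoints, and those are what the Poisson kernel intertwines.\<close>

lemma cinner_poly_op:
  fixes V :: "'a::complex_inner set"
  assumes adj: "\<And>i s. i \<in> {1..k} \<Longrightarrow> s \<in> {1..n i} \<Longrightarrow> adjoint_pair V (T i s) (Ts i s)"
    and V: "\<And>x y. x \<in> V \<Longrightarrow> y \<in> V \<Longrightarrow> x - y \<in> V"
    and F: "F \<subseteq> multiwords k n \<times> multiwords k n" and x: "x \<in> V" and y: "y \<in> V"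
  shows "cinner (poly_op V k F a T x) y = (\<Sum>(\<alpha>, \<beta>)\<in>F. a \<alpha> \<beta> *
     cinner (foldr (\<lambda>i. fold (Ts i) (\<beta> i)) [1..<Suc k] x) (fold (\<lambda>i. fold (Ts i) (\<alpha> i)) [1..<Suc k] y))"
proof -
  have p: "poly_op V k F a T x = (\<Sum>(\<alpha>, \<beta>)\<in>F. a \<alpha> \<beta> *\<^sub>C
     foldr (\<lambda>i. foldr (T i) (\<alpha> i)) [1..<Suc k] (foldr (\<lambda>i. fold (Ts i) (\<beta> i)) [1..<Suc k] x))"
    by (rule poly_op_eq[OF adj V F x])
  show ?thesis
    unfolding p cinner_sum_left
  proof (rule sum.cong[OF refl])
    fix z assume "z \<in> F"
    then obtain \<alpha> \<beta> where z: "z = (\<alpha>, \<beta>)" "\<alpha> \<in> multiwords k n" "\<beta> \<in> multiwords k n" using F by blast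
    have "foldr (\<lambda>i. fold (Ts i) (\<beta> i)) [1..<Suc k] x \<in> V"
    proof (rule foldr_in[OF _ x])
      fix i x assume i: "i \<in> set [1..<Suc k]" and "x \<in> V"
      have "adjoint_pair V (foldr (T i) (\<beta> i)) (fold (Ts i) (\<beta> i))"
        by (rule adjoint_pair_foldr, rule adj) (use i multiword_letter[OF z(3), of i] in auto)
      then show "fold (Ts i) (\<beta> i) x \<in> V" using \<open>x \<in> V\<close> unfolding adjoint_pair_def by blast
    qed
    moreover have "adjoint_pair V (foldr (\<lambda>i. foldr (T i) (\<alpha> i)) [1..<Suc k])
        (fold (\<lambda>i. fold (Ts i) (\<alpha> i)) [1..<Suc k])"
      by (rule adjoint_pair_multiword[OF adj z(2)])
    ultimately show "cinner (case z of (\<alpha>, \<beta>) \<Rightarrow> a \<alpha> \<beta> *\<^sub>C foldr (\<lambda>i. foldr (T i) (\<alpha> i)) [1..<Suc k]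
        (foldr (\<lambda>i. fold (Ts i) (\<beta> i)) [1..<Suc k] x)) y = (case z of (\<alpha>, \<beta>) \<Rightarrow> a \<alpha> \<beta> *
        cinner (foldr (\<lambda>i. fold (Ts i) (\<beta> i)) [1..<Suc k] x) (fold (\<lambda>i. fold (Ts i) (\<alpha> i)) [1..<Suc k] y))"
      using y unfolding z(1) adjoint_pair_def by (simp add: cinner_scaleC_left del: upt_Suc)
  qed
qed

section \<open>Truncated defect sums\<close>

text \<open>In terms of forms this is X \<mapsto> \<Sum> C_s^* X C_s. With C_s = r T_s^* it is the
  map \<Phi> of the row r T.\<close>

definition pull :: "(nat \<Rightarrow> 'a \<Rightarrow> 'a) \<Rightarrow> nat \<Rightarrow> ('a \<Rightarrow> 'a \<Rightarrow> complex) \<Rightarrow> 'a \<Rightarrow> 'a \<Rightarrow> complex" where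
  "pull C m B x y = (\<Sum>s\<in>{1..m}. B (C s x) (C s y))"

definition clinear :: "('a::complex_inner \<Rightarrow> 'a) \<Rightarrow> bool" where
  "clinear A \<longleftrightarrow> (\<forall>x y. A (x + y) = A x + A y) \<and> (\<forall>c x. A (c *\<^sub>C x) = c *\<^sub>C A x)"

lemma hermitian_form_pull:
  assumes C: "\<And>s. s \<in> {1..m} \<Longrightarrow> clinear (C s)" and B: "hermitian_form B"
  shows "hermitian_form (pull C m B)"
  unfolding hermitian_form_def
proof (intro conjI allI)
  fix x y z c
  show "pull C m B (x + y) z = pull C m B x z + pull C m B y z"
    unfolding pull_def sum.distrib[symmetric]
    by (rule sum.cong) (use C in \<open>simp_all add: clinear_def hermitian_formD[OF B]\<close>)
  show "pull C m B (c *\<^sub>C x) y = c * pull C m B x y"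
    unfolding pull_def sum_distrib_left
    by (rule sum.cong) (use C in \<open>simp_all add: clinear_def hermitian_formD[OF B]\<close>)
  show "pull C m B y x = cnj (pull C m B x y)"
    unfolding pull_def cnj_sum by (rule sum.cong[OF refl]) (rule hermitian_form_commute[OF B])
qed

lemma hermitian_form_diff:
  assumes "hermitian_form B" "hermitian_form B'"
  shows "hermitian_form (\<lambda>x y. B x y - B' x y)"
  unfolding hermitian_form_def
proof (intro conjI allI)
  fix x y show "B y x - B' y x = cnj (B x y - B' x y)"
    using hermitian_form_commute[OF assms(1), of y x] hermitian_form_commute[OF assms(2), of y x] by simp
qed (simp_all add: hermitian_formD[OF assms(1)] hermitian_formD[OF assms(2)] algebra_simps)

lemma hermitian_form_sum:
  assumes "finite A" "\<And>a. a \<in> A \<Longrightarrow> hermitian_form (B a)"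
  shows "hermitian_form (\<lambda>x y. \<Sum>a\<in>A. B a x y)"
  unfolding hermitian_form_def
proof (intro conjI allI)
  fix x y z c
  show "(\<Sum>a\<in>A. B a (x + y) z) = (\<Sum>a\<in>A. B a x z) + (\<Sum>a\<in>A. B a y z)"
    unfolding sum.distrib[symmetric] by (rule sum.cong[OF refl]) (simp add: hermitian_formD[OF assms(2)])
  show "(\<Sum>a\<in>A. B a (c *\<^sub>C x) y) = c * (\<Sum>a\<in>A. B a x y)"
    unfolding sum_distrib_left by (rule sum.cong[OF refl]) (simp add: hermitian_formD[OF assms(2)])
  show "(\<Sum>a\<in>A. B a y x) = cnj (\<Sum>a\<in>A. B a x y)"
    unfolding cnj_sum by (rule sum.cong[OF refl]) (rule hermitian_form_commute[OF assms(2)])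
qed

lemma pull_diff: "pull C m (\<lambda>x y. B x y - B' x y) = (\<lambda>x y. pull C m B x y - pull C m B' x y)"
  unfolding pull_def by (simp add: sum_subtractf)

lemma pull_sum: "pull C m (\<lambda>x y. \<Sum>a\<in>A. B a x y) = (\<lambda>x y. \<Sum>a\<in>A. pull C m (B a) x y)"
  unfolding pull_def by (intro ext) (rule sum.swap)

text \<open>Cauchy-Schwarz over the index s; each of the two arguments contributes a factor sqrt
  q.\<close>

lemma pull_bound:
  fixes C :: "nat \<Rightarrow> 'a::real_normed_vector \<Rightarrow> 'a"
  assumes row: "\<And>x. (\<Sum>s\<in>{1..m}. (norm (C s x))\<^sup>2) \<le> q * (norm x)\<^sup>2" and "0 \<le> q" "0 \<le> b"
    and B: "\<And>x y. cmod (B x y) \<le> b * norm x * norm y"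
  shows "cmod (pull C m B x y) \<le> b * q * norm x * norm y"
proof -
  have L2: "L2_set (\<lambda>s. norm (C s x)) {1..m} \<le> sqrt q * norm x" for x
    using real_sqrt_le_mono[OF row[of x]] by (simp add: L2_set_def real_sqrt_mult)
  have "cmod (pull C m B x y) \<le> (\<Sum>s\<in>{1..m}. cmod (B (C s x) (C s y)))"
    unfolding pull_def by (rule norm_sum)
  also have "\<dots> \<le> (\<Sum>s\<in>{1..m}. b * (\<bar>norm (C s x)\<bar> * \<bar>norm (C s y)\<bar>))"
    by (rule sum_mono) (use B in \<open>simp add: mult.assoc\<close>)
  also have "\<dots> \<le> b * (L2_set (\<lambda>s. norm (C s x)) {1..m} * L2_set (\<lambda>s. norm (C s y)) {1..m})"
    unfolding sum_distrib_left[symmetric] by (intro mult_left_mono L2_set_mult_ineq) fact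
  also have "\<dots> \<le> b * ((sqrt q * norm x) * (sqrt q * norm y))"
    by (intro mult_left_mono mult_mono L2) (use assms in auto)
  also have "\<dots> = b * (sqrt q * sqrt q) * norm x * norm y"
    by (simp only: mult_ac)
  also have "\<dots> = b * q * norm x * norm y"
    using \<open>0 \<le> q\<close> by simp
  finally show ?thesis .
qed

lemma pull_funpow_bound:
  fixes C :: "nat \<Rightarrow> 'a::real_normed_vector \<Rightarrow> 'a"
  assumes row: "\<And>x. (\<Sum>s\<in>{1..m}. (norm (C s x))\<^sup>2) \<le> q * (norm x)\<^sup>2" and "0 \<le> q" "0 \<le> b"
    and B: "\<And>x y. cmod (B x y) \<le> b * norm x * norm y"
  shows "cmod ((pull C m ^^ N) B x y) \<le> b * q ^ N * norm x * norm y"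
proof (induction N arbitrary: x y)
  case (Suc N)
  show ?case using pull_bound[OF row \<open>0 \<le> q\<close> _ Suc.IH] \<open>0 \<le> q\<close> \<open>0 \<le> b\<close> by (simp add: mult_ac)
qed (use B in simp)

text \<open>The outermost \<open>pull\<close> substitutes the letter that \<open>fold\<close>
  applies first, so induction splits off the head of the word.\<close>

lemma pull_funpow_words:
  "(pull C m ^^ N) B x y = (\<Sum>w | set w \<subseteq> {1..m} \<and> length w = N. B (fold C w x) (fold C w y))"
proof (induction N arbitrary: x y)
  case 0
  have "{w. set w \<subseteq> {1..m} \<and> length w = 0} = {[]}" by auto
  then show ?case by simp
next
  case (Suc N)
  have inj: "inj_on (\<lambda>(w, s). s # w) X" for X :: "(nat list \<times> nat) set" by (auto simp: inj_on_def)
  have "(\<Sum>w | set w \<subseteq> {1..m} \<and> length w = Suc N. B (fold C w x) (fold C w y)) =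
      (\<Sum>(w, s)\<in>{w. set w \<subseteq> {1..m} \<and> length w = N} \<times> {1..m}.
        B (fold C w (C s x)) (fold C w (C s y)))"
    unfolding lists_length_Suc_eq by (subst sum.reindex[OF inj]) (simp add: case_prod_beta)
  also have "\<dots> = (\<Sum>s\<in>{1..m}. \<Sum>w | set w \<subseteq> {1..m} \<and> length w = N.
        B (fold C w (C s x)) (fold C w (C s y)))"
    unfolding sum.cartesian_product[symmetric] by (rule sum.swap)
  also have "\<dots> = (\<Sum>s\<in>{1..m}. (pull C m ^^ N) B (C s x) (C s y))"
    by (simp only: Suc.IH)
  also have "\<dots> = (pull C m ^^ Suc N) B x y"
    unfolding funpow.simps comp_apply by (rule pull_def[symmetric])
  finally show ?case by (rule sym)
qed

text \<open>A partial geometric series in \<open>pull C m\<close>, inverting id - \<Phi> up to the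
  error \<Phi>^N.\<close>

definition trunc where
  "trunc C m N B x y = (\<Sum>j<N. (pull C m ^^ j) B x y)"

definition short_words :: "nat \<Rightarrow> nat \<Rightarrow> nat list set" where
  "short_words m N = {w \<in> lists {1..m}. length w < N}"

lemma finite_short_words: "finite (short_words m N)"
proof (rule finite_subset)
  show "short_words m N \<subseteq> {w. set w \<subseteq> {1..m} \<and> length w \<le> N}" by (auto simp: short_words_def)
qed (rule finite_lists_length_le, simp)

lemma trunc_words: "trunc C m N B x y = (\<Sum>w\<in>short_words m N. B (fold C w x) (fold C w y))"
proof (induction N)
  case 0
  then show ?case by (simp add: trunc_def short_words_def)
next
  case (Suc N)
  have "short_words m (Suc N) = short_words m N \<union> {w. set w \<subseteq> {1..m} \<and> length w = N}"
    by (auto simp: short_words_def)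
  moreover have "finite {w. set w \<subseteq> {1..m} \<and> length w = N}" by (rule finite_lists_length_eq) simp
  moreover have "short_words m N \<inter> {w. set w \<subseteq> {1..m} \<and> length w = N} = {}"
    by (auto simp: short_words_def)
  ultimately show ?case
    using Suc by (simp add: sum.union_disjoint finite_short_words trunc_def pull_funpow_words)
qed

lemma pull_funpow_diff:
  "(pull C m ^^ N) (\<lambda>x y. B x y - B' x y) = (\<lambda>x y. (pull C m ^^ N) B x y - (pull C m ^^ N) B' x y)"
  by (induction N) (auto simp: pull_diff)

lemma trunc_telescope:
  "trunc C m N (\<lambda>x y. B x y - pull C m B x y) = (\<lambda>x y. B x y - (pull C m ^^ N) B x y)"
proof -
  have "(pull C m ^^ j) (pull C m B) = (pull C m ^^ Suc j) B" for j
    by (simp add: funpow_swap1)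
  then show ?thesis
    unfolding trunc_def pull_funpow_diff 
    by (intro ext) (use sum_lessThan_telescope'[of "\<lambda>j. (pull C m ^^ j) B _ _" N] in simp)
qed

text \<open>The model is \<open>C i s\<close> = r T_{i,s}^* and q = r^2 with r < 1. Taking adjoints
  in T_{i,s} T_{j,t} = \<lambda> T_{j,t} T_{i,s} reverses the products and conjugates \<lambda>,
  whence the \<open>cnj\<close> in \<open>comm\<close>. The strict bound q < 1 makes the powers of
  each \<open>P i\<close> decay.\<close>

locale twisted_contractions =
  fixes k :: nat and n :: "nat \<Rightarrow> nat" and lam :: "nat \<Rightarrow> nat \<Rightarrow> nat \<Rightarrow> nat \<Rightarrow> complex"
    and C :: "nat \<Rightarrow> nat \<Rightarrow> 'h::complex_inner \<Rightarrow> 'h" and q :: real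
  assumes q: "0 \<le> q" "q < 1"
    and tw: "twist k n lam"
    and C_clinear: "\<And>i s. i \<in> {1..k} \<Longrightarrow> s \<in> {1..n i} \<Longrightarrow> clinear (C i s)"
    and row: "\<And>i x. i \<in> {1..k} \<Longrightarrow> (\<Sum>s\<in>{1..n i}. (norm (C i s x))\<^sup>2) \<le> q * (norm x)\<^sup>2"
    and comm: "\<And>i j s t x. i \<in> {1..k} \<Longrightarrow> j \<in> {1..k} \<Longrightarrow> i \<noteq> j \<Longrightarrow> s \<in> {1..n i} \<Longrightarrow> t \<in> {1..n j} \<Longrightarrow>
      C j t (C i s x) = cnj (lam i j s t) *\<^sub>C C i s (C j t x)"
begin

abbreviation "P i \<equiv> pull (C i) (n i)"

abbreviation "D i B x y \<equiv> B x y - P i B x y"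

definition \<Delta> :: "'h \<Rightarrow> 'h \<Rightarrow> complex" where
  "\<Delta> = foldr D [1..<Suc k] cinner"

text \<open>The list is read from the left and each word from its head. With \<open>C i s\<close>
  the scaled adjoints and l = [1, ..., k] this is the adjoint of the scaled product T_{1,\<gamma>_1}
  ... T_{k,\<gamma>_k}.\<close>

abbreviation mw :: "nat list \<Rightarrow> multiword \<Rightarrow> 'h \<Rightarrow> 'h" where
  "mw l \<gamma> \<equiv> fold (\<lambda>i. fold (C i) (\<gamma> i)) l"

section \<open>Commutation and telescoping of the defect maps\<close>

lemma hermitian_P: "i \<in> {1..k} \<Longrightarrow> hermitian_form B \<Longrightarrow> hermitian_form (P i B)"
  by (intro hermitian_form_pull C_clinear)

lemma hermitian_P_funpow: "i \<in> {1..k} \<Longrightarrow> hermitian_form B \<Longrightarrow> hermitian_form ((P i ^^ N) B)"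
  by (induction N) (auto intro: hermitian_P)

lemma hermitian_D: "i \<in> {1..k} \<Longrightarrow> hermitian_form B \<Longrightarrow> hermitian_form (D i B)"
  by (intro hermitian_form_diff hermitian_P)

lemma hermitian_trunc: "i \<in> {1..k} \<Longrightarrow> hermitian_form B \<Longrightarrow> hermitian_form (trunc (C i) (n i) N B)"
  unfolding trunc_def by (intro hermitian_form_sum hermitian_P_funpow) auto

lemma hermitian_foldr:
  assumes "\<And>i B. i \<in> {1..k} \<Longrightarrow> hermitian_form B \<Longrightarrow> hermitian_form (G i B)"
    and "set l \<subseteq> {1..k}" "hermitian_form B"
  shows "hermitian_form (foldr G l B)"
  using assms(2) by (induction l) (auto intro: assms(1,3))

lemma hermitian_\<Delta>: "hermitian_form \<Delta>"
  unfolding \<Delta>_def by (intro hermitian_foldr[OF hermitian_D] hermitian_form_cinner) auto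

text \<open>Exchanging the two letters multiplies both arguments of B by the same phase; it leaves
  the form once as itself and once conjugated, and the product is 1.\<close>

lemma P_commute:
  assumes ij: "i \<in> {1..k}" "j \<in> {1..k}" "i \<noteq> j" and B: "hermitian_form B"
  shows "P i (P j B) = P j (P i B)"
proof (intro ext)
  fix x y
  have "B (C j t (C i s x)) (C j t (C i s y)) = B (C i s (C j t x)) (C i s (C j t y))"
    if "s \<in> {1..n i}" "t \<in> {1..n j}" for s t
  proof -
    have "cmod (lam i j s t) = 1" using tw ij that unfolding twist_def by blast
    then have unit: "lam i j s t * cnj (lam i j s t) = 1" by (simp add: complex_norm_square[symmetric])
    have "B (cnj (lam i j s t) *\<^sub>C u) (cnj (lam i j s t) *\<^sub>C v) =
        (lam i j s t * cnj (lam i j s t)) * B u v" for u v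
      by (simp add: hermitian_formD(2,4)[OF B])
    then show ?thesis unfolding comm[OF ij that] unit by simp
  qed
  then have "P i (P j B) x y = (\<Sum>s\<in>{1..n i}. \<Sum>t\<in>{1..n j}. B (C i s (C j t x)) (C i s (C j t y)))"
    unfolding pull_def by (intro sum.cong refl)
  also have "\<dots> = P j (P i B) x y"
    unfolding pull_def by (rule sum.swap)
  finally show "P i (P j B) x y = P j (P i B) x y" .
qed

lemma P_funpow_commute:
  assumes "i \<in> {1..k}" "j \<in> {1..k}" "i \<noteq> j" "hermitian_form B"
  shows "(P i ^^ N) (P j B) = P j ((P i ^^ N) B)"
  by (induction N) (use assms in \<open>auto simp: P_commute hermitian_P_funpow\<close>)

lemma trunc_D_commute:
  assumes "i \<in> {1..k}" "j \<in> {1..k}" "i \<noteq> j" "hermitian_form B"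
  shows "trunc (C i) (n i) N (D j B) = D j (trunc (C i) (n i) N B)"
proof -
  have trunc: "trunc (C i) (n i) N B' = (\<lambda>x y. \<Sum>m<N. (P i ^^ m) B' x y)" for B'
    by (intro ext) (rule trunc_def)
  show ?thesis
    unfolding trunc pull_funpow_diff sum_subtractf pull_sum P_funpow_commute[OF assms] ..
qed

lemma foldr_trunc_D_commute:
  assumes "set l \<subseteq> {1..k}" "j \<in> {1..k}" "j \<notin> set l" "hermitian_form B"
  shows "foldr (\<lambda>i. trunc (C i) (n i) (M i)) l (D j B) = D j (foldr (\<lambda>i. trunc (C i) (n i) (M i)) l B)"
  using assms(1,3)
proof (induction l)
  case (Cons i l)
  have "hermitian_form (foldr (\<lambda>i. trunc (C i) (n i) (M i)) l B)"
    by (rule hermitian_foldr[OF hermitian_trunc]) (use Cons.prems assms in auto)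
  then show ?case using Cons assms(2) trunc_D_commute[of i j] by simp
qed simp

text \<open>\<open>D i\<close> moves outwards past the truncated sums of the other indices until it
  meets \<open>trunc\<close> of index i, where the geometric series telescopes. Distinctness of l is
  what allows the exchange.\<close>

lemma foldr_trunc_D:
  assumes "set l \<subseteq> {1..k}" "distinct l" "hermitian_form B"
  shows "foldr (\<lambda>i. trunc (C i) (n i) (M i)) l (foldr D l B) =
    foldr (\<lambda>i B x y. B x y - (P i ^^ M i) B x y) l B"
  using assms(1,2)
proof (induction l)
  case (Cons i l)
  have "hermitian_form (foldr D l B)"
    by (rule hermitian_foldr[OF hermitian_D]) (use Cons.prems assms in auto)
  then have "foldr (\<lambda>i. trunc (C i) (n i) (M i)) l (D i (foldr D l B)) =
      D i (foldr (\<lambda>i. trunc (C i) (n i) (M i)) l (foldr D l B))"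
    by (intro foldr_trunc_D_commute) (use Cons.prems in auto)
  then show ?case using Cons by (simp add: trunc_telescope)
qed simp

text \<open>A nested sum over the single words becomes a sum over multiwords. Writing the word of
  index i into \<gamma> does not disturb \<open>mw l \<gamma>\<close>, since i is not in l.\<close>

lemma foldr_trunc_words:
  assumes "distinct l"
  shows "foldr (\<lambda>i. trunc (C i) (n i) (M i)) l B x y =
    (\<Sum>\<gamma>\<in>(\<Pi>\<^sub>E i\<in>set l. short_words (n i) (M i)). B (mw l \<gamma> x) (mw l \<gamma> y))"
  using assms
proof (induction l arbitrary: x y)
  case (Cons i l)
  let ?W = "\<lambda>i. short_words (n i) (M i)"
  have inj: "inj_on (\<lambda>(w, \<gamma>). \<gamma>(i := w)) (?W i \<times> Pi\<^sub>E (set l) ?W)"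
    using Cons.prems by (intro inj_combinator) simp
  have mw: "mw l (\<gamma>(i := w)) z = mw l \<gamma> z" for \<gamma> w z
    by (rule fold_cong) (use Cons.prems in auto)
  have "foldr (\<lambda>i. trunc (C i) (n i) (M i)) (i # l) B x y =
      (\<Sum>w\<in>?W i. \<Sum>\<gamma>\<in>Pi\<^sub>E (set l) ?W. B (mw l \<gamma> (fold (C i) w x)) (mw l \<gamma> (fold (C i) w y)))"
    using Cons by (simp add: trunc_words[of _ _ _ "foldr (\<lambda>i. trunc (C i) (n i) (M i)) l B"])
  also have "\<dots> = (\<Sum>(w, \<gamma>)\<in>?W i \<times> Pi\<^sub>E (set l) ?W. B (mw (i # l) (\<gamma>(i := w)) x) (mw (i # l) (\<gamma>(i := w)) y))"
    unfolding sum.cartesian_product[symmetric] by (simp add: mw del: fun_upd_apply add: fun_upd_same)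
  also have "\<dots> = (\<Sum>\<gamma>\<in>Pi\<^sub>E (set (i # l)) ?W. B (mw (i # l) \<gamma> x) (mw (i # l) \<gamma> y))"
    unfolding list.set(2) PiE_insert_eq
    by (subst sum.reindex[OF inj]) (simp add: case_prod_beta del: fold_simps fun_upd_apply)
  finally show ?case .
qed simp

text \<open>Each factor id - \<Phi>_i^M subtracts a power applied to a form that itself varies with
  N. Those forms are bounded uniformly in N, with a factor 2 for each index, so the subtracted term
  is at most a constant times q^M.\<close>

lemma foldr_defect_tendsto:
  assumes "set l \<subseteq> {1..k}" and "\<And>i. i \<in> {1..k} \<Longrightarrow> filterlim (\<lambda>N. M N i) at_top sequentially"
  shows "(\<lambda>N. foldr (\<lambda>i B x y. B x y - (P i ^^ M N i) B x y) l cinner x y) \<longlonglongrightarrow> cinner x y"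
  using assms(1)
proof (induction l)
  case (Cons i l)
  let ?E = "\<lambda>N l. foldr (\<lambda>i B x y. B x y - (P i ^^ M N i) B x y) l cinner"
  have bound: "cmod (?E N l x y) \<le> 2 ^ length l * norm x * norm y" if "set l \<subseteq> {1..k}" for l N x y
    using that
  proof (induction l arbitrary: x y)
    case Nil
    then show ?case using cmod_cinner_le by simp
  next
    case (Cons j l)
    then have j: "j \<in> {1..k}" and l: "set l \<subseteq> {1..k}" by auto
    have "cmod (?E N (j # l) x y) \<le> cmod (?E N l x y) + cmod ((P j ^^ M N j) (?E N l) x y)"
      by (simp add: norm_triangle_ineq4)
    also have "\<dots> \<le> 2 ^ length l * norm x * norm y + 2 ^ length l * q ^ M N j * norm x * norm y"
      by (intro add_mono Cons.IH l pull_funpow_bound row j q) auto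
    also have "\<dots> \<le> 2 ^ length l * norm x * norm y + 2 ^ length l * 1 * norm x * norm y"
      by (intro add_left_mono mult_right_mono mult_left_mono power_le_one) (use q in auto)
    finally show ?case by (simp add: mult_ac)
  qed
  have i: "i \<in> {1..k}" and l: "set l \<subseteq> {1..k}" using Cons.prems by auto
  have "(\<lambda>N. q ^ M N i) \<longlonglongrightarrow> 0"
    using filterlim_compose[OF LIMSEQ_realpow_zero[OF q] assms(2)[OF i]] .
  then have lim: "(\<lambda>N. 2 ^ length l * q ^ M N i * norm x * norm y) \<longlonglongrightarrow> 0"
    by (auto intro!: tendsto_mult_left_zero tendsto_mult_right_zero)
  have "(\<lambda>N. (P i ^^ M N i) (?E N l) x y) \<longlonglongrightarrow> 0"
    by (rule Lim_null_comparison[OF _ lim], rule always_eventually, rule allI)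
       (intro pull_funpow_bound row i q bound l, simp)
  from tendsto_diff[OF Cons.IH[OF l] this] show ?case by simp
qed simp

text \<open>This is the isometry of the Poisson kernel with respect to \<Delta>. The sides of the
  box may differ by coordinate, because the shifts by words treated later shorten each side by its
  own amount.\<close>

lemma truncated_defect_tendsto:
  assumes "\<And>i. i \<in> {1..k} \<Longrightarrow> filterlim (\<lambda>N. M N i) at_top sequentially"
  shows "(\<lambda>N. \<Sum>\<gamma>\<in>(\<Pi>\<^sub>E i\<in>{1..k}. short_words (n i) (M N i)).
      \<Delta> (mw [1..<Suc k] \<gamma> x) (mw [1..<Suc k] \<gamma> y)) \<longlonglongrightarrow> cinner x y"
proof -
  have set: "set [1..<Suc k] = {1..k}" by auto
  have D: "foldr (\<lambda>i. trunc (C i) (n i) (M N i)) [1..<Suc k] \<Delta> =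
      foldr (\<lambda>i B x y. B x y - (P i ^^ M N i) B x y) [1..<Suc k] cinner" for N
    unfolding \<Delta>_def by (rule foldr_trunc_D) (auto intro: hermitian_form_cinner simp del: upt_Suc)
  have "(\<Sum>\<gamma>\<in>(\<Pi>\<^sub>E i\<in>{1..k}. short_words (n i) (M N i)).
      \<Delta> (mw [1..<Suc k] \<gamma> x) (mw [1..<Suc k] \<gamma> y)) =
    foldr (\<lambda>i B x y. B x y - (P i ^^ M N i) B x y) [1..<Suc k] cinner x y" for N
    using foldr_trunc_words[of "[1..<Suc k]" "M N" \<Delta> x y] unfolding set D
    by (simp del: upt_Suc)
  then show ?thesis using foldr_defect_tendsto[of "[1..<Suc k]" M x y] assms unfolding set by simp
qed

end

section \<open>Operators on square-summable families\<close>

lemma ell2_coord_sum: "finite F \<Longrightarrow> ell2_coord (sum f F) x = (\<Sum>i\<in>F. ell2_coord (f i) x)"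
  by (induction F rule: finite_induct) (auto simp: ell2_coord_simps)

lemma cinner_ell2_basis: "cinner f (ell2_basis x) = ell2_coord f x"
proof -
  have "cinner f (ell2_basis x) = (\<Sum>\<^sub>\<infinity>y\<in>{x}. ell2_coord f y * cnj (ell2_coord (ell2_basis x) y))"
    unfolding cinner_ell2_def by (rule infsum_cong_neutral) (auto simp: ell2_basis.rep_eq)
  then show ?thesis by (simp add: ell2_basis.rep_eq)
qed

definition ell2_vec :: "'a set \<Rightarrow> ('a \<Rightarrow> complex) \<Rightarrow> 'a ell2" where
  "ell2_vec G \<phi> = (\<Sum>x\<in>G. \<phi> x *\<^sub>C ell2_basis x)"

lemma ell2_coord_vec: "finite G \<Longrightarrow> ell2_coord (ell2_vec G \<phi>) x = (if x \<in> G then \<phi> x else 0)"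
  by (simp add: ell2_vec_def ell2_coord_sum ell2_coord_simps ell2_basis.rep_eq
      if_distrib[of "\<lambda>z. _ * z"] cong: if_cong)

lemma ell2_vec_in: "finite G \<Longrightarrow> G \<subseteq> A \<Longrightarrow> ell2_vec G \<phi> \<in> ell2_on A"
  by (auto simp: ell2_on_def ell2_coord_vec)

lemma norm_ell2_vec: "finite G \<Longrightarrow> (norm (ell2_vec G \<phi>))\<^sup>2 = (\<Sum>x\<in>G. (cmod (\<phi> x))\<^sup>2)"
proof -
  assume G: "finite G"
  have "(norm (ell2_vec G \<phi>))\<^sup>2 = (\<Sum>\<^sub>\<infinity>x\<in>G. (cmod (\<phi> x))\<^sup>2)"
    unfolding norm_ell2_square by (rule infsum_cong_neutral) (auto simp: ell2_coord_vec G)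
  then show ?thesis using G by simp
qed

text \<open>The squared error of a finite partial sum is the corresponding tail of the series for
  the squared norm. The expansion is what gives meaning to the infinite sum in
  \<open>standard_tuple\<close>.\<close>

lemma ell2_expansion:
  assumes f: "f \<in> ell2_on A"
  shows "((\<lambda>x. ell2_coord f x *\<^sub>C ell2_basis x) has_sum f) A"
proof -
  let ?g = "\<lambda>x. (cmod (ell2_coord f x))\<^sup>2"
  have norm_diff: "(norm (ell2_vec F (ell2_coord f) - f))\<^sup>2 = (norm f)\<^sup>2 - sum ?g F" if "finite F" for F
  proof -
    have "(norm (ell2_vec F (ell2_coord f) - f))\<^sup>2 = (\<Sum>\<^sub>\<infinity>x\<in>UNIV - F. ?g x)"
      unfolding norm_ell2_square
      by (rule infsum_cong_neutral) (auto simp: ell2_coord_simps ell2_coord_vec that)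
    also have "\<dots> = (\<Sum>\<^sub>\<infinity>x. ?g x) - (\<Sum>\<^sub>\<infinity>x\<in>F. ?g x)"
      by (rule infsum_Diff) (auto simp: ell2_coord_summable that)
    finally show ?thesis using that by (simp add: norm_ell2_square)
  qed
  have "?g summable_on A" by (rule summable_on_subset_banach[OF ell2_coord_summable]) simp
  moreover have "infsum ?g A = infsum ?g UNIV"
    by (rule infsum_cong_neutral) (use f in \<open>auto simp: ell2_on_def\<close>)
  ultimately have "(?g has_sum (norm f)\<^sup>2) A"
    unfolding norm_ell2_square by (simp add: has_sum_iff)
  then have "((\<lambda>F. (norm f)\<^sup>2 - sum ?g F) \<longlongrightarrow> (norm f)\<^sup>2 - (norm f)\<^sup>2) (finite_subsets_at_top A)"
    unfolding has_sum_def by (intro tendsto_intros)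
  moreover have "\<forall>\<^sub>F F in finite_subsets_at_top A.
      (norm f)\<^sup>2 - sum ?g F = (norm (ell2_vec F (ell2_coord f) - f))\<^sup>2"
    by (rule eventually_finite_subsets_at_top_weakI) (simp add: norm_diff)
  ultimately have "((\<lambda>F. (norm (ell2_vec F (ell2_coord f) - f))\<^sup>2) \<longlongrightarrow> 0) (finite_subsets_at_top A)"
    using Lim_transform_eventually by fastforce
  from tendsto_real_sqrt[OF this]
  have "((\<lambda>F. norm (ell2_vec F (ell2_coord f) - f)) \<longlongrightarrow> 0) (finite_subsets_at_top A)" by simp
  then show ?thesis
    unfolding has_sum_def ell2_vec_def by (simp add: tendsto_norm_zero_iff LIM_zero_iff)
qed

text \<open>The shape of the operators S_{i,s}^*, which read a family at the index with a letter
  prepended. Injectivity of \<tau> and weights of modulus at most 1 make the family square-summable,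
  so that \<open>Abs_ell2\<close> is applied within its domain, and the map a contraction.\<close>

definition weighted_comp :: "'a set \<Rightarrow> ('a \<Rightarrow> complex) \<Rightarrow> ('a \<Rightarrow> 'a) \<Rightarrow> 'a ell2 \<Rightarrow> 'a ell2" where
  "weighted_comp A u \<tau> f = Abs_ell2 (\<lambda>x. if x \<in> A then u x * ell2_coord f (\<tau> x) else 0)"

context
  fixes A :: "'a set" and u :: "'a \<Rightarrow> complex" and \<tau> :: "'a \<Rightarrow> 'a"
  assumes inj: "inj_on \<tau> A" and u: "\<And>x. x \<in> A \<Longrightarrow> cmod (u x) \<le> 1"
begin

lemma weighted_comp_sum_le:
  assumes "finite F"
  shows "(\<Sum>x\<in>F. (cmod (if x \<in> A then u x * ell2_coord f (\<tau> x) else 0))\<^sup>2) \<le> (norm f)\<^sup>2"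
proof -
  have "(\<Sum>x\<in>F. (cmod (if x \<in> A then u x * ell2_coord f (\<tau> x) else 0))\<^sup>2) =
      (\<Sum>x\<in>F \<inter> A. (cmod (u x * ell2_coord f (\<tau> x)))\<^sup>2)"
    by (rule sum.mono_neutral_cong_right) (use assms in auto)
  also have "\<dots> \<le> (\<Sum>x\<in>F \<inter> A. (cmod (ell2_coord f (\<tau> x)))\<^sup>2)"
    by (intro sum_mono power_mono) (auto simp: norm_mult intro!: mult_left_le_one_le u)
  also have "\<dots> = (\<Sum>y\<in>\<tau> ` (F \<inter> A). (cmod (ell2_coord f y))\<^sup>2)"
    by (rule sum.reindex_cong[symmetric, OF inj_on_subset[OF inj]]) auto
  also have "\<dots> \<le> (norm f)\<^sup>2" by (rule sum_coord_le_norm_ell2) (use assms in auto)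
  finally show ?thesis .
qed

lemma weighted_comp_summable:
  "(\<lambda>x. (cmod (if x \<in> A then u x * ell2_coord f (\<tau> x) else 0))\<^sup>2) summable_on UNIV"
  by (rule nonneg_bdd_above_summable_on) (auto intro!: bdd_aboveI2 weighted_comp_sum_le)

lemma ell2_coord_weighted_comp:
  "ell2_coord (weighted_comp A u \<tau> f) x = (if x \<in> A then u x * ell2_coord f (\<tau> x) else 0)"
  unfolding weighted_comp_def by (subst Abs_ell2_inverse) (rule CollectI, rule weighted_comp_summable, rule refl)

lemma norm_weighted_comp_le: "norm (weighted_comp A u \<tau> f) \<le> norm f"
proof (rule power2_le_imp_le)
  show "(norm (weighted_comp A u \<tau> f))\<^sup>2 \<le> (norm f)\<^sup>2"
    unfolding norm_ell2_square[of "weighted_comp A u \<tau> f"] ell2_coord_weighted_comp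
    by (rule infsum_le_finite_sums[OF weighted_comp_summable weighted_comp_sum_le])
qed simp

lemma bounded_clinear_weighted_comp: "bounded_clinear (weighted_comp A u \<tau>)"
  unfolding bounded_clinear_def
proof (intro conjI allI)
  show "bounded_linear (weighted_comp A u \<tau>)"
    by (rule bounded_linear_intro[where K = 1])
      (auto intro!: ell2_eqI norm_weighted_comp_le simp: ell2_coord_weighted_comp ell2_coord_simps algebra_simps)
qed (auto intro!: ell2_eqI simp: ell2_coord_weighted_comp ell2_coord_simps)

end

section \<open>The adjoints of the standard tuple\<close>

definition phase :: "(nat \<Rightarrow> nat \<Rightarrow> nat \<Rightarrow> nat \<Rightarrow> complex) \<Rightarrow> nat \<Rightarrow> nat \<Rightarrow> multiword \<Rightarrow> complex" where
  "phase lam i s \<gamma> = (\<Prod>j\<in>{1..<i}. prod_list (map (lam i j s) (\<gamma> j)))"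

definition standard_adjoint ::
  "nat \<Rightarrow> (nat \<Rightarrow> nat) \<Rightarrow> (nat \<Rightarrow> nat \<Rightarrow> nat \<Rightarrow> nat \<Rightarrow> complex) \<Rightarrow> multiword ell2 tuple" where
  "standard_adjoint k n lam i s =
    weighted_comp (multiwords k n) (\<lambda>\<gamma>. cnj (phase lam i s \<gamma>)) (\<lambda>\<gamma>. \<gamma>(i := s # \<gamma> i))"

lemma ell2_on_diff: "x \<in> ell2_on A \<Longrightarrow> y \<in> ell2_on A \<Longrightarrow> x - y \<in> ell2_on A"
  by (simp add: ell2_on_def ell2_coord_simps)

context
  fixes k :: nat and n :: "nat \<Rightarrow> nat" and lam :: "nat \<Rightarrow> nat \<Rightarrow> nat \<Rightarrow> nat \<Rightarrow> complex" and i s :: nat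
  assumes tw: "twist k n lam" and i: "i \<in> {1..k}" and s: "s \<in> {1..n i}"
begin

lemma inj_prepend: "inj_on (\<lambda>\<gamma>::multiword. \<gamma>(i := s # \<gamma> i)) X"
proof (rule inj_onI)
  fix \<gamma> \<delta> :: multiword
  assume "\<gamma>(i := s # \<gamma> i) = \<delta>(i := s # \<delta> i)"
  then have "(\<gamma>(i := s # \<gamma> i)) j = (\<delta>(i := s # \<delta> i)) j" for j by simp
  then show "\<gamma> = \<delta>" by (intro ext) (metis fun_upd_apply list.inject)
qed

lemma cmod_phase: "\<gamma> \<in> multiwords k n \<Longrightarrow> cmod (cnj (phase lam i s \<gamma>)) \<le> 1"
proof -
  assume \<gamma>: "\<gamma> \<in> multiwords k n"
  have "cmod (prod_list (map (lam i j s) w)) = 1" if "j \<in> {1..<i}" "set w \<subseteq> {1..n j}" for j w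
    using that(2)
  proof (induction w)
    case (Cons t w)
    moreover have "j \<in> {1..k}" "i \<noteq> j" using that(1) i by auto
    moreover have "t \<in> {1..n j}" using Cons.prems by simp
    ultimately have "cmod (lam i j s t) = 1" using tw i s unfolding twist_def by blast
    then show ?case using Cons by (simp add: norm_mult)
  qed simp
  then have "cmod (prod_list (map (lam i j s) (\<gamma> j))) = 1" if "j \<in> {1..<i}" for j
    using that i multiword_letter[OF \<gamma>, of j] by (auto simp: subset_iff)
  then show ?thesis by (simp add: phase_def prod_norm[symmetric])
qed

lemma prepend_multiword: "\<gamma> \<in> multiwords k n \<Longrightarrow> \<gamma>(i := s # \<gamma> i) \<in> multiwords k n"
  using i s unfolding multiwords_def by (auto simp: PiE_iff extensional_def)

lemma ell2_coord_standard_adjoint: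
  "ell2_coord (standard_adjoint k n lam i s f) \<gamma> =
    (if \<gamma> \<in> multiwords k n then cnj (phase lam i s \<gamma>) * ell2_coord f (\<gamma>(i := s # \<gamma> i)) else 0)"
  unfolding standard_adjoint_def by (rule ell2_coord_weighted_comp[OF inj_prepend cmod_phase])

lemma norm_standard_adjoint_le: "norm (standard_adjoint k n lam i s f) \<le> norm f"
  unfolding standard_adjoint_def by (rule norm_weighted_comp_le[OF inj_prepend cmod_phase])

text \<open>The explicit map \<open>standard_adjoint\<close> is bounded and so has an adjoint W. On
  basis vectors W is given by the prescription for S_{i,s}, and continuity identifies it with the
  infinite sum defining \<open>standard_tuple\<close> on the subspace.\<close>

lemma adjoint_pair_standard:
  "adjoint_pair (ell2_on (multiwords k n)) (standard_tuple k n lam i s) (standard_adjoint k n lam i s)"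
proof -
  let ?V = "ell2_on (multiwords k n)" and ?Ss = "standard_adjoint k n lam i s"
  have "bounded_clinear ?Ss"
    unfolding standard_adjoint_def by (rule bounded_clinear_weighted_comp[OF inj_prepend cmod_phase])
  then obtain W where W: "bounded_clinear W" "\<And>x y. cinner (?Ss x) y = cinner x (W y)"
    using adjoint_exists by blast
  have W': "cinner (W x) y = cinner x (?Ss y)" for x y
    using W(2)[of y x] cinner_commute by metis
  have W_basis: "W (ell2_basis \<alpha>) = phase lam i s \<alpha> *\<^sub>C ell2_basis (\<alpha>(i := s # \<alpha> i))"
    if "\<alpha> \<in> multiwords k n" for \<alpha>
  proof (rule ell2_eqI)
    fix \<gamma>
    have "ell2_coord (W (ell2_basis \<alpha>)) \<gamma> = cnj (cinner (?Ss (ell2_basis \<gamma>)) (ell2_basis \<alpha>))"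
      unfolding cinner_ell2_basis[of "W _", symmetric] W' by (rule cinner_commute)
    then show "ell2_coord (W (ell2_basis \<alpha>)) \<gamma> =
        ell2_coord (phase lam i s \<alpha> *\<^sub>C ell2_basis (\<alpha>(i := s # \<alpha> i))) \<gamma>"
      using that by (auto simp: cinner_ell2_basis ell2_coord_standard_adjoint ell2_coord_simps
          ell2_basis.rep_eq simp del: fun_upd_apply)
  qed
  have S: "standard_tuple k n lam i s f = W f" if "f \<in> ?V" for f
  proof -
    have "((\<lambda>\<alpha>. W (ell2_coord f \<alpha> *\<^sub>C ell2_basis \<alpha>)) has_sum W f) (multiwords k n)"
      using W(1) unfolding bounded_clinear_def
      by (intro has_sum_bounded_linear[OF _ ell2_expansion[OF that], unfolded o_def]) simp
    then have "(\<Sum>\<^sub>\<infinity>\<alpha>\<in>multiwords k n. W (ell2_coord f \<alpha> *\<^sub>C ell2_basis \<alpha>)) = W f"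
      by (rule infsumI)
    moreover have "W (ell2_coord f \<alpha> *\<^sub>C ell2_basis \<alpha>) =
        ell2_coord f \<alpha> *\<^sub>C (phase lam i s \<alpha> *\<^sub>C ell2_basis (\<alpha>(i := s # \<alpha> i)))"
      if "\<alpha> \<in> multiwords k n" for \<alpha>
      using W(1) W_basis[OF that] by (simp add: bounded_clinear_def)
    ultimately show ?thesis
      unfolding standard_tuple_def phase_def[symmetric] by (metis (no_types, lifting) infsum_cong)
  qed
  have "W f \<in> ?V" for f
  proof -
    have "ell2_coord (W f) \<gamma> = 0" if "\<gamma> \<notin> multiwords k n" for \<gamma>
    proof -
      \<comment> \<open>A prepended multiword is again a multiword, so \<open>?Ss\<close> never
        reads the coordinate \<gamma>.\<close>
      have "?Ss (ell2_basis \<gamma>) = 0"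
        using that prepend_multiword
        by (intro ell2_eqI) (auto simp: ell2_coord_standard_adjoint ell2_coord_simps ell2_basis.rep_eq
            simp del: fun_upd_apply)
      then show ?thesis using W'[of f "ell2_basis \<gamma>"] by (simp add: cinner_ell2_basis)
    qed
    then show ?thesis by (simp add: ell2_on_def)
  qed
  moreover have "?Ss f \<in> ?V" for f by (simp add: ell2_on_def ell2_coord_standard_adjoint)
  ultimately show ?thesis using S W' by (auto simp: adjoint_pair_def)
qed

end

section \<open>Boundedness of polynomials in the standard tuple\<close>

lemma adjoint_pair_contraction:
  assumes AB: "adjoint_pair V A B" and B: "\<And>x. x \<in> V \<Longrightarrow> norm (B x) \<le> norm x" and x: "x \<in> V"
  shows "norm (A x) \<le> norm x"
proof (cases "A x = 0")
  case False
  have Ax: "A x \<in> V" using AB x by (auto simp: adjoint_pair_def)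
  have "(norm (A x))\<^sup>2 = cmod (cinner (A x) (A x))" by (simp add: cinner_self norm_power)
  also have "\<dots> = cmod (cinner x (B (A x)))" using AB x Ax by (auto simp: adjoint_pair_def)
  also have "\<dots> \<le> norm x * norm (A x)"
    by (rule order_trans[OF cmod_cinner_le]) (intro mult_left_mono B Ax, simp)
  finally show ?thesis using False by (simp add: power2_eq_square)
qed simp

definition contraction_on :: "'a::real_normed_vector set \<Rightarrow> ('a \<Rightarrow> 'a) \<Rightarrow> bool" where
  "contraction_on V A \<longleftrightarrow> (\<forall>x\<in>V. A x \<in> V \<and> norm (A x) \<le> norm x)"

lemma contraction_on_foldr:
  "(\<And>i. i \<in> set l \<Longrightarrow> contraction_on V (A i)) \<Longrightarrow> contraction_on V (foldr A l)"
proof (induction l)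
  case (Cons i l)
  then have "contraction_on V (A i)" "contraction_on V (foldr A l)" by auto
  then show ?case unfolding contraction_on_def by (auto intro: order_trans)
qed (simp add: contraction_on_def)

lemma contraction_on_fold:
  "(\<And>i. i \<in> set l \<Longrightarrow> contraction_on V (A i)) \<Longrightarrow> contraction_on V (fold A l)"
proof (induction l)
  case (Cons i l)
  then have "contraction_on V (A i)" "contraction_on V (fold A l)" by auto
  then show ?case unfolding contraction_on_def by (auto intro: order_trans)
qed (simp add: contraction_on_def)

text \<open>Some bound K is required first: the real supremum dominates its members only when the
  quotients are bounded above.\<close>

lemma norm_le_onorm_on:
  assumes bound: "\<And>x. x \<in> V \<Longrightarrow> norm (A x) \<le> K * norm x" and x: "x \<in> V"
  shows "norm (A x) \<le> onorm_on V A * norm x"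
proof (cases "x = 0")
  case True
  then show ?thesis using bound[OF x] by simp
next
  case False
  \<comment> \<open>The vector 0 contributes the quotient 0, so the bound has to be nonnegative and
    the absolute value of K is taken.\<close>
  have "norm (A y) / norm y \<le> \<bar>K\<bar>" if "y \<in> V" for y
  proof -
    have "norm (A y) \<le> \<bar>K\<bar> * norm y" using bound[OF that] by (meson abs_ge_self mult_right_mono norm_ge_zero order_trans)
    then show ?thesis by (cases "y = 0") (auto simp: divide_le_eq)
  qed
  then have "bdd_above ((\<lambda>x. norm (A x) / norm x) ` V)" by (auto intro!: bdd_aboveI2)
  then have "norm (A x) / norm x \<le> onorm_on V A" unfolding onorm_on_def by (rule cSUP_upper[OF x])
  then show ?thesis using False by (simp add: divide_le_eq)
qed

text \<open>All letters are contractions of V, so the sum of the moduli of the coefficients is a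
  crude bound; it ensures that the supremum in \<open>onorm_on\<close> is attained by no vector
  exceeding it.\<close>

lemma poly_op_standard_bound:
  fixes a k n lam F
  defines "V \<equiv> ell2_on (multiwords k n)"
  defines "p \<equiv> poly_op V k F a (standard_tuple k n lam)"
  assumes tw: "twist k n lam" and F: "finite F" "F \<subseteq> multiwords k n \<times> multiwords k n" and f: "f \<in> V"
  shows "norm (p f) \<le> onorm_on V p * norm f"
proof (rule norm_le_onorm_on[OF _ f])
  fix f assume f: "f \<in> V"
  let ?S = "standard_tuple k n lam" and ?Ss = "standard_adjoint k n lam"
  have adj: "adjoint_pair V (?S i s) (?Ss i s)" if "i \<in> {1..k}" "s \<in> {1..n i}" for i s
    unfolding V_def by (rule adjoint_pair_standard[OF tw that])
  have Ss: "contraction_on V (?Ss i s)" if "i \<in> {1..k}" "s \<in> {1..n i}" for i s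
    using adj[OF that] norm_standard_adjoint_le[OF tw that]
    by (auto simp: contraction_on_def adjoint_pair_def)
  have S: "contraction_on V (?S i s)" if "i \<in> {1..k}" "s \<in> {1..n i}" for i s
    using adj[OF that] norm_standard_adjoint_le[OF tw that] adjoint_pair_contraction[OF adj[OF that]]
    by (auto simp: contraction_on_def adjoint_pair_def)
  have p: "p f = (\<Sum>(\<alpha>, \<beta>)\<in>F. a \<alpha> \<beta> *\<^sub>C foldr (\<lambda>i. foldr (?S i) (\<alpha> i)) [1..<Suc k]
      (foldr (\<lambda>i. fold (?Ss i) (\<beta> i)) [1..<Suc k] f))"
    unfolding p_def by (rule poly_op_eq[OF adj _ F(2) f]) (simp_all add: V_def ell2_on_diff)
  have "norm (p f) \<le> (\<Sum>(\<alpha>, \<beta>)\<in>F. cmod (a \<alpha> \<beta>) * norm f)"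
    unfolding p
  proof (rule sum_norm_le)
    fix z assume "z \<in> F"
    then obtain \<alpha> \<beta> where z: "z = (\<alpha>, \<beta>)" "\<alpha> \<in> multiwords k n" "\<beta> \<in> multiwords k n" using F by blast
    let ?A = "foldr (\<lambda>i. foldr (?S i) (\<alpha> i)) [1..<Suc k]" and ?B = "foldr (\<lambda>i. fold (?Ss i) (\<beta> i)) [1..<Suc k]"
    have "contraction_on V ?A"
    proof (rule contraction_on_foldr, rule contraction_on_foldr)
      fix i s assume "i \<in> set [1..<Suc k]" "s \<in> set (\<alpha> i)"
      then show "contraction_on V (?S i s)" by (intro S multiword_letter[OF z(2)]) auto
    qed
    moreover have "contraction_on V ?B"
    proof (rule contraction_on_foldr, rule contraction_on_fold)
      fix i s assume "i \<in> set [1..<Suc k]" "s \<in> set (\<beta> i)"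
      then show "contraction_on V (?Ss i s)" by (intro Ss multiword_letter[OF z(3)]) auto
    qed
    ultimately have "norm (?A (?B f)) \<le> norm f"
      using f unfolding contraction_on_def by (meson order_trans)
    then show "norm (case z of (\<alpha>, \<beta>) \<Rightarrow> a \<alpha> \<beta> *\<^sub>C foldr (\<lambda>i. foldr (?S i) (\<alpha> i)) [1..<Suc k]
        (foldr (\<lambda>i. fold (?Ss i) (\<beta> i)) [1..<Suc k] f)) \<le> (case z of (\<alpha>, \<beta>) \<Rightarrow> cmod (a \<alpha> \<beta>) * norm f)"
      unfolding z by (simp add: norm_scaleC mult_left_mono del: upt_Suc)
  qed
  then show "norm (p f) \<le> (\<Sum>(\<alpha>, \<beta>)\<in>F. cmod (a \<alpha> \<beta>)) * norm f"
    by (simp add: sum_distrib_right case_prod_beta)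
qed

section \<open>The Poisson transform\<close>

lemma clinear_fold:
  "(\<And>s. s \<in> set w \<Longrightarrow> clinear (A s)) \<Longrightarrow> clinear (fold A w)"
  by (induction w) (auto simp: clinear_def)

declare One_nat_def [simp del] upt_Suc [simp del]

text \<open>The coordinates to be changed are given as a list so that the map can be built by
  induction; for [1, ..., k] it is coordinatewise concatenation.\<close>

definition prepend :: "nat list \<Rightarrow> multiword \<Rightarrow> multiword \<Rightarrow> multiword" where
  "prepend l \<beta> \<gamma> = (\<lambda>i. if i \<in> set l then \<beta> i @ \<gamma> i else \<gamma> i)"

context twisted_contractions
begin

abbreviation "words \<equiv> multiwords k n"

abbreviation "V \<equiv> ell2_on words"

text \<open>Operators \<open>U\<close> and \<open>A\<close> intertwined by the Poisson kernel \<open>h \<mapsto> (mw [1..<Suc k] \<gamma> h)\<^sub>\<gamma>\<close>: both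
  act on families as the same weighted composition with \<open>\<tau>\<close>.\<close>

definition shifts :: "(multiword ell2 \<Rightarrow> multiword ell2) \<Rightarrow> ('h \<Rightarrow> 'h) \<Rightarrow> (multiword \<Rightarrow> multiword) \<Rightarrow> bool" where
  "shifts U A \<tau> \<longleftrightarrow> U ` V \<subseteq> V \<and> \<tau> ` words \<subseteq> words \<and> (\<exists>u. \<forall>\<gamma>\<in>words.
     (\<forall>f\<in>V. ell2_coord (U f) \<gamma> = u \<gamma> * ell2_coord f (\<tau> \<gamma>)) \<and>
     (\<forall>h. mw [1..<Suc k] \<gamma> (A h) = u \<gamma> *\<^sub>C mw [1..<Suc k] (\<tau> \<gamma>) h))"

lemma shifts_id: "shifts id id id"
  unfolding shifts_def by (intro conjI exI[of _ "\<lambda>_. 1"]) (auto)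

text \<open>Reading U (U' f) at \<gamma> leads first to \<tau> \<gamma> and from there to \<tau>'
  (\<tau> \<gamma>): the index maps compose in the opposite order, and the second weight is taken at
  \<tau> \<gamma>.\<close>

lemma shifts_comp:
  assumes "shifts U A \<tau>" "shifts U' A' \<tau>'"
  shows "shifts (U \<circ> U') (A \<circ> A') (\<tau>' \<circ> \<tau>)"
proof -
  obtain u where u: "U ` V \<subseteq> V" "\<tau> ` words \<subseteq> words"
    "\<And>\<gamma> f. \<gamma> \<in> words \<Longrightarrow> f \<in> V \<Longrightarrow> ell2_coord (U f) \<gamma> = u \<gamma> * ell2_coord f (\<tau> \<gamma>)"
    "\<And>\<gamma> h. \<gamma> \<in> words \<Longrightarrow> mw [1..<Suc k] \<gamma> (A h) = u \<gamma> *\<^sub>C mw [1..<Suc k] (\<tau> \<gamma>) h"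
    using assms(1) unfolding shifts_def by blast
  obtain u' where u': "U' ` V \<subseteq> V" "\<tau>' ` words \<subseteq> words"
    "\<And>\<gamma> f. \<gamma> \<in> words \<Longrightarrow> f \<in> V \<Longrightarrow> ell2_coord (U' f) \<gamma> = u' \<gamma> * ell2_coord f (\<tau>' \<gamma>)"
    "\<And>\<gamma> h. \<gamma> \<in> words \<Longrightarrow> mw [1..<Suc k] \<gamma> (A' h) = u' \<gamma> *\<^sub>C mw [1..<Suc k] (\<tau>' \<gamma>) h"
    using assms(2) unfolding shifts_def by blast
  have \<tau>: "\<tau> \<gamma> \<in> words" if "\<gamma> \<in> words" for \<gamma> using that u(2) by blast
  have U': "U' f \<in> V" if "f \<in> V" for f using that u'(1) by blast
  show ?thesis
    unfolding shifts_def
  proof (intro conjI exI[of _ "\<lambda>\<gamma>. u \<gamma> * u' (\<tau> \<gamma>)"] ballI allI)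
    show "(U \<circ> U') ` V \<subseteq> V" "(\<tau>' \<circ> \<tau>) ` words \<subseteq> words" using u(1,2) u'(1,2) by (auto simp: image_subset_iff)
  next
    fix \<gamma> f assume "\<gamma> \<in> words" "f \<in> V"
    then show "ell2_coord ((U \<circ> U') f) \<gamma> = u \<gamma> * u' (\<tau> \<gamma>) * ell2_coord f ((\<tau>' \<circ> \<tau>) \<gamma>)"
      by (simp add: u(3) u'(3) \<tau> U')
  next
    fix \<gamma> h assume "\<gamma> \<in> words"
    then show "mw [1..<Suc k] \<gamma> ((A \<circ> A') h) = (u \<gamma> * u' (\<tau> \<gamma>)) *\<^sub>C mw [1..<Suc k] ((\<tau>' \<circ> \<tau>) \<gamma>) h"
      by (simp add: u(4) u'(4) \<tau> scaleC_scaleC)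
  qed
qed

section \<open>Intertwining relations of the Poisson kernel\<close>

lemma clinear_word: "\<gamma> \<in> words \<Longrightarrow> i \<in> {1..k} \<Longrightarrow> clinear (fold (C i) (\<gamma> i))"
  by (rule clinear_fold, rule C_clinear) (use multiword_letter in blast)+

lemma clinear_mw: "\<gamma> \<in> words \<Longrightarrow> set l \<subseteq> {1..k} \<Longrightarrow> clinear (mw l \<gamma>)"
  by (rule clinear_fold, rule clinear_word) auto

text \<open>\<open>C i s\<close> moves outwards past the letters of w, each of which costs one
  conjugated entry of the matrix with index (i, j).\<close>

lemma word_twist:
  assumes "i \<in> {1..k}" "j \<in> {1..k}" "i \<noteq> j" "s \<in> {1..n i}" "set w \<subseteq> {1..n j}"
  shows "fold (C j) w (C i s h) = cnj (prod_list (map (lam i j s) w)) *\<^sub>C C i s (fold (C j) w h)"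
  using assms(5)
proof (induction w arbitrary: h)
  case (Cons t w)
  then have t: "t \<in> {1..n j}" and w: "set w \<subseteq> {1..n j}" by auto
  have "clinear (fold (C j) w)"
    by (rule clinear_fold) (use w assms(2) C_clinear in blast)
  then have "fold (C j) (t # w) (C i s h) = cnj (lam i j s t) *\<^sub>C fold (C j) w (C i s (C j t h))"
    using comm[OF assms(1-4) t] by (simp add: clinear_def)
  then show ?case using Cons.IH[OF w] by (simp add: scaleC_scaleC)
qed simp

lemma mw_twist:
  assumes "i \<in> {1..k}" "s \<in> {1..n i}" "\<gamma> \<in> words" "set l \<subseteq> {1..k}" "i \<notin> set l" "distinct l"
  shows "mw l \<gamma> (C i s h) = cnj (\<Prod>j\<in>set l. prod_list (map (lam i j s) (\<gamma> j))) *\<^sub>C C i s (mw l \<gamma> h)"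
  using assms(4-6)
proof (induction l arbitrary: h)
  case (Cons j l)
  then have j: "j \<in> {1..k}" "i \<noteq> j" and l: "set l \<subseteq> {1..k}" "i \<notin> set l" "distinct l" by auto
  have "set (\<gamma> j) \<subseteq> {1..n j}" using multiword_letter[OF assms(3) j(1)] by blast
  then have "mw (j # l) \<gamma> (C i s h) =
      cnj (prod_list (map (lam i j s) (\<gamma> j))) *\<^sub>C mw l \<gamma> (C i s (fold (C j) (\<gamma> j) h))"
    using word_twist[OF assms(1) j assms(2)] clinear_mw[OF assms(3) l(1)] by (simp add: clinear_def)
  then show ?case using Cons.IH[OF l] Cons.prems by (simp add: scaleC_scaleC)
qed simp

text \<open>\<open>C i s\<close> acts first and has to pass the words of indices below i to reach
  its own. The scalars collected are exactly the conjugate of the phase in the definition of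
  S_{i,s}. There it becomes the head of word i, the letter that \<open>fold\<close> applies
  first.\<close>

lemma shifts_letter:
  assumes i: "i \<in> {1..k}" and s: "s \<in> {1..n i}"
  shows "shifts (standard_adjoint k n lam i s) (C i s) (\<lambda>\<gamma>. \<gamma>(i := s # \<gamma> i))"
  unfolding shifts_def
proof (intro conjI exI[of _ "\<lambda>\<gamma>. cnj (phase lam i s \<gamma>)"] ballI allI)
  show "standard_adjoint k n lam i s ` V \<subseteq> V"
    using adjoint_pair_standard[OF tw i s] by (simp add: adjoint_pair_def)
  show "(\<lambda>\<gamma>. \<gamma>(i := s # \<gamma> i)) ` words \<subseteq> words"
    using prepend_multiword[OF tw i s] by blast
  show "ell2_coord (standard_adjoint k n lam i s f) \<gamma> = cnj (phase lam i s \<gamma>) * ell2_coord f (\<gamma>(i := s # \<gamma> i))"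
    if "\<gamma> \<in> words" for \<gamma> f
    using that by (simp add: ell2_coord_standard_adjoint[OF tw i s])
  show "mw [1..<Suc k] \<gamma> (C i s h) = cnj (phase lam i s \<gamma>) *\<^sub>C mw [1..<Suc k] (\<gamma>(i := s # \<gamma> i)) h"
    if \<gamma>: "\<gamma> \<in> words" for \<gamma> h
  proof -
    have "[1..<Suc k] = [1..<i] @ [i..<Suc k]"
      using upt_add_eq_append[of 1 i "Suc k - i"] i by simp
    then have split: "[1..<Suc k] = [1..<i] @ i # [Suc i..<Suc k]"
      using i by (simp add: upt_conv_Cons)
    have "set [1..<i] \<subseteq> {1..k}" and tail: "set (i # [Suc i..<Suc k]) \<subseteq> {1..k}" using i by auto
    then have "mw [1..<i] \<gamma> (C i s h) = cnj (phase lam i s \<gamma>) *\<^sub>C C i s (mw [1..<i] \<gamma> h)"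
      using mw_twist[OF i s \<gamma>, of "[1..<i]" h] by (simp add: phase_def)
    moreover have "clinear (\<lambda>x. mw [Suc i..<Suc k] \<gamma> (fold (C i) (\<gamma> i) x))"
      using clinear_mw[OF \<gamma> tail] by (simp add: o_def)
    ultimately have "mw [1..<Suc k] \<gamma> (C i s h) = cnj (phase lam i s \<gamma>) *\<^sub>C
        mw [Suc i..<Suc k] \<gamma> (fold (C i) (\<gamma> i) (C i s (mw [1..<i] \<gamma> h)))"
      unfolding split by (simp add: clinear_def)
    moreover have "mw [Suc i..<Suc k] (\<gamma>(i := s # \<gamma> i)) x = mw [Suc i..<Suc k] \<gamma> x"
        "mw [1..<i] (\<gamma>(i := s # \<gamma> i)) x = mw [1..<i] \<gamma> x" for x
      by (rule fold_cong; auto)+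
    ultimately show ?thesis unfolding split by (simp)
  qed
qed

lemma shifts_word:
  assumes i: "i \<in> {1..k}" and "set w \<subseteq> {1..n i}"
  shows "shifts (fold (standard_adjoint k n lam i) w) (fold (C i) w) (\<lambda>\<gamma>. \<gamma>(i := w @ \<gamma> i))"
  using assms(2)
proof (induction w)
  case Nil
  then show ?case using shifts_id by (simp add: id_def)
next
  case (Cons s w)
  then have s: "s \<in> {1..n i}" and w: "set w \<subseteq> {1..n i}" by auto
  have "(\<lambda>\<gamma>. \<gamma>(i := s # \<gamma> i)) \<circ> (\<lambda>\<gamma>. \<gamma>(i := w @ \<gamma> i)) = (\<lambda>\<gamma>. \<gamma>(i := (s # w) @ \<gamma> i))"
    by (simp add: o_def)
  then show ?case
    using shifts_comp[OF Cons.IH[OF w] shifts_letter[OF i s]] by (simp only: fold_Cons)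
qed

text \<open>Both orders of the factors occur: one acts on the argument of the polynomial, the other
  arises by moving T_\<alpha> across the inner product. They share one index map since prepending in
  distinct coordinates commutes; their different weights are hidden in
  \<open>shifts\<close>.\<close>

lemma shifts_multiword:
  assumes \<beta>: "\<beta> \<in> words" and "set l \<subseteq> {1..k}" "distinct l"
  shows "shifts (foldr (\<lambda>i. fold (standard_adjoint k n lam i) (\<beta> i)) l) (foldr (\<lambda>i. fold (C i) (\<beta> i)) l)
      (prepend l \<beta>)"
    and "shifts (fold (\<lambda>i. fold (standard_adjoint k n lam i) (\<beta> i)) l) (mw l \<beta>) (prepend l \<beta>)"
proof -
  have \<beta>i: "shifts (fold (standard_adjoint k n lam i) (\<beta> i)) (fold (C i) (\<beta> i)) (\<lambda>\<gamma>. \<gamma>(i := \<beta> i @ \<gamma> i))"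
    if "i \<in> {1..k}" for i
    by (rule shifts_word[OF that]) (use multiword_letter[OF \<beta> that] in blast)
  have nil: "prepend [] \<beta> = id" by (simp add: prepend_def fun_eq_iff)
  have cons: "prepend (i # l) \<beta> = prepend l \<beta> \<circ> (\<lambda>\<gamma>. \<gamma>(i := \<beta> i @ \<gamma> i))"
    "prepend (i # l) \<beta> = (\<lambda>\<gamma>. \<gamma>(i := \<beta> i @ \<gamma> i)) \<circ> prepend l \<beta>" if "i \<notin> set l" for i l
    using that by (auto simp: prepend_def fun_eq_iff)
  show "shifts (foldr (\<lambda>i. fold (standard_adjoint k n lam i) (\<beta> i)) l) (foldr (\<lambda>i. fold (C i) (\<beta> i)) l)
      (prepend l \<beta>)"
    using assms(2,3)
  proof (induction l)
    case (Cons i l)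
    then have i: "i \<in> {1..k}" "i \<notin> set l" and l: "set l \<subseteq> {1..k}" "distinct l" by auto
    show ?case
      unfolding foldr.simps cons(1)[OF i(2)] by (rule shifts_comp[OF \<beta>i[OF i(1)] Cons.IH[OF l]])
  qed (use shifts_id in \<open>simp add: nil id_def\<close>)
  show "shifts (fold (\<lambda>i. fold (standard_adjoint k n lam i) (\<beta> i)) l) (mw l \<beta>) (prepend l \<beta>)"
    using assms(2,3)
  proof (induction l)
    case (Cons i l)
    then have i: "i \<in> {1..k}" "i \<notin> set l" and l: "set l \<subseteq> {1..k}" "distinct l" by auto
    show ?case
      unfolding fold_Cons cons(2)[OF i(2)] by (rule shifts_comp[OF Cons.IH[OF l] \<beta>i[OF i(1)]])
  qed (use shifts_id in \<open>simp add: nil id_def\<close>)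
qed

section \<open>The kernel truncated to a box\<close>

abbreviation box :: "(nat \<Rightarrow> nat) \<Rightarrow> multiword set" where
  "box M \<equiv> (\<Pi>\<^sub>E i\<in>{1..k}. short_words (n i) (M i))"

abbreviation "E M x y \<equiv> (\<Sum>\<gamma>\<in>box M. \<Delta> (mw [1..<Suc k] \<gamma> x) (mw [1..<Suc k] \<gamma> y))"

lemma finite_box: "finite (box M)"
  by (intro finite_PiE finite_short_words) simp

lemma box_subset: "box M \<subseteq> words"
  unfolding multiwords_def by (rule PiE_mono) (auto simp: short_words_def)

text \<open>Lengths add under concatenation, so both constraints together cut each side by the
  longer of the two words.\<close>

lemma prepend_box:
  assumes "\<alpha> \<in> words" "\<beta> \<in> words"
  shows "{\<gamma> \<in> words. prepend [1..<Suc k] \<alpha> \<gamma> \<in> box (\<lambda>_. N) \<and> prepend [1..<Suc k] \<beta> \<gamma> \<in> box (\<lambda>_. N)} =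
    box (\<lambda>i. N - max (length (\<alpha> i)) (length (\<beta> i)))"
proof -
  have pre: "prepend [1..<Suc k] \<beta> \<gamma> \<in> box (\<lambda>_. N) \<longleftrightarrow> (\<forall>i\<in>{1..k}. length (\<beta> i) + length (\<gamma> i) < N)"
    if "\<beta> \<in> words" "\<gamma> \<in> words" for \<beta> \<gamma>
    using that unfolding multiwords_def prepend_def
    by (auto simp: PiE_iff short_words_def extensional_def)
  have box: "\<gamma> \<in> box M \<longleftrightarrow> \<gamma> \<in> words \<and> (\<forall>i\<in>{1..k}. length (\<gamma> i) < M i)" for \<gamma> M
    by (auto simp: multiwords_def PiE_iff short_words_def)
  \<comment> \<open>Truncated subtraction is harmless: it yields 0 exactly when no l satisfies the
    right-hand side.\<close>
  have cut: "l < N - max a b \<longleftrightarrow> a + l < N \<and> b + l < N" for a b l :: nat by linarith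
  show ?thesis
  proof (rule set_eqI)
    fix \<gamma>
    show "\<gamma> \<in> {\<gamma> \<in> words. prepend [1..<Suc k] \<alpha> \<gamma> \<in> box (\<lambda>_. N) \<and> prepend [1..<Suc k] \<beta> \<gamma> \<in> box (\<lambda>_. N)} \<longleftrightarrow>
        \<gamma> \<in> box (\<lambda>i. N - max (length (\<alpha> i)) (length (\<beta> i)))"
    proof (cases "\<gamma> \<in> words")
      case True
      show ?thesis
        unfolding mem_Collect_eq pre[OF assms(1) True] pre[OF assms(2) True]
        unfolding box cut using True by blast
    next
      case False
      then show ?thesis unfolding box by blast
    qed
  qed
qed

text \<open>Only those \<gamma> contribute whose two shifted indices both lie in the box. For these,
  summing over l reassembles \<Delta>, and sesquilinearity absorbs the weights into the kernel
  entries of A h and A' h'.\<close>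

lemma sum_cinner_shifts:
  assumes "shifts U A (prepend [1..<Suc k] \<beta>)" "shifts U' A' (prepend [1..<Suc k] \<alpha>)"
    and \<alpha>\<beta>: "\<alpha> \<in> words" "\<beta> \<in> words"
    and c: "\<And>\<gamma> \<delta>. \<gamma> \<in> box (\<lambda>_. N) \<Longrightarrow> \<delta> \<in> box (\<lambda>_. N) \<Longrightarrow>
      \<Delta> (mw [1..<Suc k] \<gamma> h) (mw [1..<Suc k] \<delta> h') = (\<Sum>l<(m::nat). c l \<gamma> * cnj (d l \<delta>))"
  shows "(\<Sum>l<m. cinner (U (ell2_vec (box (\<lambda>_. N)) (c l))) (U' (ell2_vec (box (\<lambda>_. N)) (d l)))) =
    E (\<lambda>i. N - max (length (\<beta> i)) (length (\<alpha> i))) (A h) (A' h')"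
proof -
  let ?G = "box (\<lambda>_. N)" and ?\<tau> = "prepend [1..<Suc k] \<beta>" and ?\<tau>' = "prepend [1..<Suc k] \<alpha>"
  define G where "G = {\<gamma> \<in> words. ?\<tau> \<gamma> \<in> ?G \<and> ?\<tau>' \<gamma> \<in> ?G}"
  have G: "G = box (\<lambda>i. N - max (length (\<beta> i)) (length (\<alpha> i)))"
    unfolding G_def by (rule prepend_box) fact+
  obtain u where u: "U ` V \<subseteq> V"
    "\<And>\<gamma> f. \<gamma> \<in> words \<Longrightarrow> f \<in> V \<Longrightarrow> ell2_coord (U f) \<gamma> = u \<gamma> * ell2_coord f (?\<tau> \<gamma>)"
    "\<And>\<gamma> h. \<gamma> \<in> words \<Longrightarrow> mw [1..<Suc k] \<gamma> (A h) = u \<gamma> *\<^sub>C mw [1..<Suc k] (?\<tau> \<gamma>) h"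
    using assms(1) unfolding shifts_def by blast
  obtain u' where u': "U' ` V \<subseteq> V"
    "\<And>\<gamma> f. \<gamma> \<in> words \<Longrightarrow> f \<in> V \<Longrightarrow> ell2_coord (U' f) \<gamma> = u' \<gamma> * ell2_coord f (?\<tau>' \<gamma>)"
    "\<And>\<gamma> h. \<gamma> \<in> words \<Longrightarrow> mw [1..<Suc k] \<gamma> (A' h) = u' \<gamma> *\<^sub>C mw [1..<Suc k] (?\<tau>' \<gamma>) h"
    using assms(2) unfolding shifts_def by blast
  have vec: "ell2_vec ?G \<phi> \<in> V" for \<phi> by (rule ell2_vec_in[OF finite_box box_subset])
  have coord: "ell2_coord (ell2_vec ?G \<phi>) x = (if x \<in> ?G then \<phi> x else 0)" for \<phi> x
    by (rule ell2_coord_vec[OF finite_box])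
  have "cinner (U (ell2_vec ?G (c l))) (U' (ell2_vec ?G (d l))) =
      (\<Sum>\<gamma>\<in>G. u \<gamma> * c l (?\<tau> \<gamma>) * cnj (u' \<gamma> * d l (?\<tau>' \<gamma>)))" for l
  proof -
    let ?x = "U (ell2_vec ?G (c l))" and ?y = "U' (ell2_vec ?G (d l))"
    have "?x \<in> V" using u(1) vec by blast
    then have outside: "ell2_coord ?x \<gamma> = 0" if "\<gamma> \<notin> words" for \<gamma>
      using that by (simp add: ell2_on_def)
    have "cinner ?x ?y = (\<Sum>\<^sub>\<infinity>\<gamma>\<in>G. u \<gamma> * c l (?\<tau> \<gamma>) * cnj (u' \<gamma> * d l (?\<tau>' \<gamma>)))"
      unfolding cinner_ell2_def
    proof (rule infsum_cong_neutral)
      fix \<gamma> assume "\<gamma> \<in> UNIV - G"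
      then have "\<gamma> \<notin> words \<or> ?\<tau> \<gamma> \<notin> ?G \<or> ?\<tau>' \<gamma> \<notin> ?G" by (simp add: G_def)
      then show "ell2_coord ?x \<gamma> * cnj (ell2_coord ?y \<gamma>) = 0"
        by (cases "\<gamma> \<in> words") (auto simp: outside u(2) u'(2) vec coord)
    next
      fix \<gamma> assume "\<gamma> \<in> UNIV \<inter> G"
      then show "ell2_coord ?x \<gamma> * cnj (ell2_coord ?y \<gamma>) =
          u \<gamma> * c l (?\<tau> \<gamma>) * cnj (u' \<gamma> * d l (?\<tau>' \<gamma>))"
        by (simp add: G_def u(2) u'(2) vec coord)
    qed simp
    then show ?thesis using finite_box by (simp add: G)
  qed
  then have "(\<Sum>l<m. cinner (U (ell2_vec ?G (c l))) (U' (ell2_vec ?G (d l)))) =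
      (\<Sum>l<m. \<Sum>\<gamma>\<in>G. u \<gamma> * c l (?\<tau> \<gamma>) * cnj (u' \<gamma> * d l (?\<tau>' \<gamma>)))"
    by simp
  also have "\<dots> = (\<Sum>\<gamma>\<in>G. \<Sum>l<m. u \<gamma> * c l (?\<tau> \<gamma>) * cnj (u' \<gamma> * d l (?\<tau>' \<gamma>)))"
    by (rule sum.swap)
  also have "\<dots> = (\<Sum>\<gamma>\<in>G. \<Delta> (mw [1..<Suc k] \<gamma> (A h)) (mw [1..<Suc k] \<gamma> (A' h')))"
  proof (rule sum.cong[OF refl])
    fix \<gamma> assume "\<gamma> \<in> G"
    then have \<gamma>: "\<gamma> \<in> words" "?\<tau> \<gamma> \<in> ?G" "?\<tau>' \<gamma> \<in> ?G" by (auto simp: G_def)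
    have "\<Delta> (mw [1..<Suc k] \<gamma> (A h)) (mw [1..<Suc k] \<gamma> (A' h')) =
        u \<gamma> * cnj (u' \<gamma>) * (\<Sum>l<m. c l (?\<tau> \<gamma>) * cnj (d l (?\<tau>' \<gamma>)))"
      unfolding u(3)[OF \<gamma>(1)] u'(3)[OF \<gamma>(1)] c[OF \<gamma>(2,3), symmetric]
      by (simp add: hermitian_formD(2,4)[OF hermitian_\<Delta>])
    then show "(\<Sum>l<m. u \<gamma> * c l (?\<tau> \<gamma>) * cnj (u' \<gamma> * d l (?\<tau>' \<gamma>))) =
        \<Delta> (mw [1..<Suc k] \<gamma> (A h)) (mw [1..<Suc k] \<gamma> (A' h'))"
      by (simp add: sum_distrib_left mult_ac)
  qed
  finally show ?thesis unfolding G .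
qed

text \<open>The polynomial has its adjoints in the order \<open>T\<^sub>1\<^sup>* \<dots> T\<^sub>k\<^sup>*\<close>, opposite to that in \<open>(T\<^sub>1 \<dots> T\<^sub>k)\<^sup>*\<close>.\<close>

abbreviation "mw_rev \<beta> \<equiv> foldr (\<lambda>i. fold (C i) (\<beta> i)) [1..<Suc k]"

lemma poly_form_bound:
  assumes pos: "\<And>x. 0 \<le> Re (\<Delta> x x)"
    and F: "finite F" "F \<subseteq> words \<times> words"
    and K: "0 \<le> K" "\<And>f. f \<in> V \<Longrightarrow> norm (poly_op V k F a (standard_tuple k n lam) f) \<le> K * norm f"
  shows "cmod (\<Sum>(\<alpha>, \<beta>)\<in>F. a \<alpha> \<beta> * cinner (mw_rev \<beta> h) (mw [1..<Suc k] \<alpha> h')) \<le> K * norm h * norm h'"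
proof -
  let ?S = "standard_tuple k n lam" and ?Ss = "standard_adjoint k n lam"
  let ?p = "poly_op V k F a ?S"
  let ?cut = "\<lambda>\<alpha> \<beta> N i. N - max (length (\<beta> i)) (length (\<alpha> i))"
  have range: "set [1..<Suc k] \<subseteq> {1..k}" by auto
  have adj: "adjoint_pair V (?S i s) (?Ss i s)" if "i \<in> {1..k}" "s \<in> {1..n i}" for i s
    by (rule adjoint_pair_standard[OF tw that])
  have bound: "cmod (\<Sum>(\<alpha>, \<beta>)\<in>F. a \<alpha> \<beta> * E (?cut \<alpha> \<beta> N) (mw_rev \<beta> h) (mw [1..<Suc k] \<alpha> h')) \<le>
      K * (sqrt (Re (E (\<lambda>_. N) h h)) * sqrt (Re (E (\<lambda>_. N) h' h')))" for N
  proof -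
    let ?G = "box (\<lambda>_. N)" and ?mw = "\<lambda>\<gamma>. mw [1..<Suc k] \<gamma>"
    \<comment> \<open>The entries of both truncated kernels are factored together, so that one
      family c serves h and h'.\<close>
    define X where "X = (\<lambda>\<gamma>. ?mw \<gamma> h) ` ?G \<union> (\<lambda>\<gamma>. ?mw \<gamma> h') ` ?G"
    have "finite X" unfolding X_def by (intro finite_UnI finite_imageI finite_box)
    from hermitian_form_factor[OF this hermitian_\<Delta> pos]
    obtain m :: nat and c where c: "\<forall>x\<in>X. \<forall>y\<in>X. \<Delta> x y = (\<Sum>l<m. c l x * cnj (c l y))"
      by (elim exE)
    have X: "?mw \<gamma> h \<in> X" "?mw \<gamma> h' \<in> X" if "\<gamma> \<in> ?G" for \<gamma>
      using that unfolding X_def by blast+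
    define f where "f x l = ell2_vec ?G (\<lambda>\<gamma>. c l (?mw \<gamma> x))" for x l
    have f: "f x l \<in> V" for x l unfolding f_def by (rule ell2_vec_in[OF finite_box box_subset])
    \<comment> \<open>The vectors f x l together carry the truncated squared norm of x, since the
      diagonal of the factorisation is a sum of squared moduli.\<close>
    have norm_f: "L2_set (\<lambda>l. norm (f x l)) {..<m} = sqrt (Re (E (\<lambda>_. N) x x))" if "x = h \<or> x = h'" for x
    proof -
      have "(\<Sum>l<m. (norm (f x l))\<^sup>2) = (\<Sum>\<gamma>\<in>?G. \<Sum>l<m. (cmod (c l (?mw \<gamma> x)))\<^sup>2)"
        unfolding f_def norm_ell2_vec[OF finite_box] by (rule sum.swap)
      also have "\<dots> = (\<Sum>\<gamma>\<in>?G. Re (\<Delta> (?mw \<gamma> x) (?mw \<gamma> x)))"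
      proof (rule sum.cong[OF refl])
        fix \<gamma> assume "\<gamma> \<in> ?G"
        then have "\<Delta> (?mw \<gamma> x) (?mw \<gamma> x) = (\<Sum>l<m. c l (?mw \<gamma> x) * cnj (c l (?mw \<gamma> x)))"
          using that X by (intro c[rule_format]) auto
        then show "(\<Sum>l<m. (cmod (c l (?mw \<gamma> x)))\<^sup>2) = Re (\<Delta> (?mw \<gamma> x) (?mw \<gamma> x))"
          by (simp only: complex_norm_square[symmetric] of_real_sum[symmetric] Re_complex_of_real)
      qed
      finally show ?thesis unfolding L2_set_def by (simp only: Re_sum)
    qed
    have "cinner (?p (f h l)) (f h' l) = (\<Sum>(\<alpha>, \<beta>)\<in>F. a \<alpha> \<beta> *
        cinner (foldr (\<lambda>i. fold (?Ss i) (\<beta> i)) [1..<Suc k] (f h l))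
          (fold (\<lambda>i. fold (?Ss i) (\<alpha> i)) [1..<Suc k] (f h' l)))" for l
      by (rule cinner_poly_op[OF adj _ F(2) f f]) (simp_all add: ell2_on_diff)
    then have "(\<Sum>l<m. cinner (?p (f h l)) (f h' l)) = (\<Sum>l<m. \<Sum>(\<alpha>, \<beta>)\<in>F. a \<alpha> \<beta> *
        cinner (foldr (\<lambda>i. fold (?Ss i) (\<beta> i)) [1..<Suc k] (f h l))
          (fold (\<lambda>i. fold (?Ss i) (\<alpha> i)) [1..<Suc k] (f h' l)))"
      by (simp only:)
    also have "\<dots> = (\<Sum>(\<alpha>, \<beta>)\<in>F. a \<alpha> \<beta> * E (?cut \<alpha> \<beta> N) (mw_rev \<beta> h) (mw [1..<Suc k] \<alpha> h'))"
      unfolding sum.swap[of _ F]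
    proof (rule sum.cong[OF refl])
      fix z assume "z \<in> F"
      then obtain \<alpha> \<beta> where z: "z = (\<alpha>, \<beta>)" "\<alpha> \<in> words" "\<beta> \<in> words" using F by blast
      have "(\<Sum>l<m. cinner (foldr (\<lambda>i. fold (?Ss i) (\<beta> i)) [1..<Suc k] (f h l))
          (fold (\<lambda>i. fold (?Ss i) (\<alpha> i)) [1..<Suc k] (f h' l))) = E (?cut \<alpha> \<beta> N) (mw_rev \<beta> h) (mw [1..<Suc k] \<alpha> h')"
        unfolding f_def
        by (rule sum_cinner_shifts[OF shifts_multiword(1)[OF z(3) range distinct_upt]
            shifts_multiword(2)[OF z(2) range distinct_upt] z(2,3)]) (intro c[rule_format] X)
      then show "(\<Sum>l<m. case z of (\<alpha>, \<beta>) \<Rightarrow> a \<alpha> \<beta> *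
        cinner (foldr (\<lambda>i. fold (?Ss i) (\<beta> i)) [1..<Suc k] (f h l))
          (fold (\<lambda>i. fold (?Ss i) (\<alpha> i)) [1..<Suc k] (f h' l))) =
        (case z of (\<alpha>, \<beta>) \<Rightarrow> a \<alpha> \<beta> * E (?cut \<alpha> \<beta> N) (mw_rev \<beta> h) (mw [1..<Suc k] \<alpha> h'))"
        unfolding z(1) by (simp only: prod.case sum_distrib_left[symmetric])
    qed
    finally have "cmod (\<Sum>(\<alpha>, \<beta>)\<in>F. a \<alpha> \<beta> * E (?cut \<alpha> \<beta> N) (mw_rev \<beta> h) (mw [1..<Suc k] \<alpha> h')) =
        cmod (\<Sum>l<m. cinner (?p (f h l)) (f h' l))" by (simp only:)
    also have "\<dots> \<le> (\<Sum>l<m. K * (\<bar>norm (f h l)\<bar> * \<bar>norm (f h' l)\<bar>))"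
    proof (rule sum_norm_le)
      fix l
      have "cmod (cinner (?p (f h l)) (f h' l)) \<le> norm (?p (f h l)) * norm (f h' l)" by (rule cmod_cinner_le)
      also have "\<dots> \<le> (K * norm (f h l)) * norm (f h' l)" by (intro mult_right_mono K f) simp
      finally show "cmod (cinner (?p (f h l)) (f h' l)) \<le> K * (\<bar>norm (f h l)\<bar> * \<bar>norm (f h' l)\<bar>)"
        by (simp add: mult.assoc)
    qed
    also have "\<dots> \<le> K * (L2_set (\<lambda>l. norm (f h l)) {..<m} * L2_set (\<lambda>l. norm (f h' l)) {..<m})"
      unfolding sum_distrib_left[symmetric] by (intro mult_left_mono L2_set_mult_ineq K)
    finally show ?thesis unfolding norm_f[OF disjI1[OF refl]] norm_f[OF disjI2[OF refl]] .
  qed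
  \<comment> \<open>The words \<alpha> and \<beta> are fixed, so the shortened boxes still exhaust
    all multiwords.\<close>
  have cut: "filterlim (\<lambda>N. ?cut \<alpha> \<beta> N i) at_top sequentially" for \<alpha> \<beta> i
    by (rule filterlim_minus_const_nat_at_top)
  have lim: "(\<lambda>N. sqrt (Re (E (\<lambda>_. N) x x))) \<longlonglongrightarrow> norm x" for x
  proof -
    have "(\<lambda>N. sqrt (Re (E (\<lambda>_. N) x x))) \<longlonglongrightarrow> sqrt (Re (cinner x x))"
      by (intro tendsto_intros truncated_defect_tendsto filterlim_ident)
    then show ?thesis by (simp add: cinner_self)
  qed
  show ?thesis
  proof (rule tendsto_le[OF sequentially_bot])
    show "(\<lambda>N. K * (sqrt (Re (E (\<lambda>_. N) h h)) * sqrt (Re (E (\<lambda>_. N) h' h')))) \<longlonglongrightarrow> K * norm h * norm h'"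
      unfolding mult.assoc by (intro tendsto_intros lim)
    show "(\<lambda>N. cmod (\<Sum>(\<alpha>, \<beta>)\<in>F. a \<alpha> \<beta> * E (?cut \<alpha> \<beta> N) (mw_rev \<beta> h) (mw [1..<Suc k] \<alpha> h'))) \<longlonglongrightarrow>
        cmod (\<Sum>(\<alpha>, \<beta>)\<in>F. a \<alpha> \<beta> * cinner (mw_rev \<beta> h) (mw [1..<Suc k] \<alpha> h'))"
      unfolding case_prod_beta by (intro tendsto_intros truncated_defect_tendsto cut)
    show "\<forall>\<^sub>F N in sequentially. cmod (\<Sum>(\<alpha>, \<beta>)\<in>F. a \<alpha> \<beta> * E (?cut \<alpha> \<beta> N) (mw_rev \<beta> h) (mw [1..<Suc k] \<alpha> h')) \<le>
      K * (sqrt (Re (E (\<lambda>_. N) h h)) * sqrt (Re (E (\<lambda>_. N) h' h')))"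
      by (rule always_eventually) (use bound in blast)
  qed
qed

end

section \<open>Comparison with the standard tuple\<close>

lemma bounded_bilinear_cinner: "bounded_bilinear cinner"
proof
  show "\<exists>K. \<forall>x y. norm (cinner x y) \<le> norm x * norm y * K"
    by (intro exI[of _ 1]) (simp add: cmod_cinner_le)
qed (simp_all add: cinner_add_left cinner_add_right scaleR_scaleC cinner_scaleC_left
    cinner_scaleC_right scaleR_conv_of_real)

text \<open>The hypothesis is stated along convergent families \<open>g\<close> because the
  operators and the vectors they act on vary with r at the same time.\<close>

lemma tendsto_fold:
  assumes "\<And>i g x. i \<in> set l \<Longrightarrow> (g \<longlongrightarrow> x) F \<Longrightarrow> ((\<lambda>r. A r i (g r)) \<longlongrightarrow> B i x) F" and "(g \<longlongrightarrow> x) F"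
  shows "((\<lambda>r. fold (A r) l (g r)) \<longlongrightarrow> fold B l x) F"
  using assms by (induction l arbitrary: g x) auto

lemma tendsto_foldr:
  assumes "\<And>i g x. i \<in> set l \<Longrightarrow> (g \<longlongrightarrow> x) F \<Longrightarrow> ((\<lambda>r. A r i (g r)) \<longlongrightarrow> B i x) F" and "(g \<longlongrightarrow> x) F"
  shows "((\<lambda>r. foldr (A r) l (g r)) \<longlongrightarrow> foldr B l x) F"
  using assms by (induction l) auto

lemma cadjoint_bounded:
  fixes A :: "'a::chilbert_space \<Rightarrow> 'a"
  assumes "bounded_clinear A"
  shows "bounded_clinear (cadjoint A)" "cinner (A x) y = cinner x (cadjoint A y)"
proof -
  obtain B where B: "bounded_clinear B" "\<And>x y. cinner (A x) y = cinner x (B y)"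
    using adjoint_exists[OF assms] by blast
  then have "adjoint_pair UNIV A B" by (simp add: adjoint_pair_def)
  then have "cadjoint A y = B y" for y by (rule cadjoint_on_eq) auto
  then have "cadjoint A = B" by (rule ext)
  with B show "bounded_clinear (cadjoint A)" "cinner (A x) y = cinner x (cadjoint A y)" by simp_all
qed

theorem corollary4p8:
  fixes k :: nat and n :: "nat \<Rightarrow> nat"
    and lam :: "nat \<Rightarrow> nat \<Rightarrow> nat \<Rightarrow> nat \<Rightarrow> complex"
    and T :: "nat \<Rightarrow> nat \<Rightarrow> 'h::chilbert_space \<Rightarrow> 'h"
    and F :: "(multiword \<times> multiword) set"
    and a :: "multiword \<Rightarrow> multiword \<Rightarrow> complex"
  assumes "1 \<le> k" and "\<forall>i\<in>{1..k}. 1 \<le> n i"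
    and "twist k n lam"
    and "T \<in> regular_polyball k n lam"
    and "finite F" and "F \<subseteq> multiwords k n \<times> multiwords k n"
  shows "onorm (poly_op UNIV k F a T) \<le>
    onorm_on (ell2_on (multiwords k n))
      (poly_op (ell2_on (multiwords k n)) k F a (standard_tuple k n lam))"
proof -
  note tw = assms(3) and T = assms(4)[unfolded regular_polyball_def mem_Collect_eq] and F = assms(5,6)
  define K where "K = onorm_on (ell2_on (multiwords k n))
      (poly_op (ell2_on (multiwords k n)) k F a (standard_tuple k n lam))"
  have K: "norm (poly_op (ell2_on (multiwords k n)) k F a (standard_tuple k n lam) f) \<le> K * norm f"
    if "f \<in> ell2_on (multiwords k n)" for f
    unfolding K_def by (rule poly_op_standard_bound[OF tw F that])
  have K0: "0 \<le> K"
  proof -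
    \<comment> \<open>The vacuum vector, at the tuple of empty words, is a nonzero element of the
      space on which the bound can be tested.\<close>
    define f :: "multiword ell2" where "f = ell2_basis (\<lambda>i\<in>{1..k}. [])"
    have "(\<lambda>i\<in>{1..k}. []) \<in> multiwords k n" by (simp add: multiwords_def)
    then have "f \<in> ell2_on (multiwords k n)"
      by (auto simp: f_def ell2_on_def ell2_basis.rep_eq)
    moreover have "f \<noteq> 0"
    proof
      assume "f = 0"
      then have "ell2_coord f (\<lambda>i\<in>{1..k}. []) = 0" by (simp add: ell2_coord_simps)
      then show False by (simp add: f_def ell2_basis.rep_eq)
    qed
    ultimately show ?thesis
      using order_trans[OF norm_ge_zero K[of f]] by (simp add: zero_le_mult_iff)
  qed
  define Ts where "Ts i s = cadjoint (T i s)" for i s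
  have bounded: "bounded_clinear (T i s)" if "i \<in> {1..k}" "s \<in> {1..n i}" for i s
    using T that by blast
  have Ts: "bounded_clinear (Ts i s)" if "i \<in> {1..k}" "s \<in> {1..n i}" for i s
    unfolding Ts_def by (rule cadjoint_bounded(1)[OF bounded[OF that]])
  have adj: "cinner (T i s x) y = cinner x (Ts i s y)" if "i \<in> {1..k}" "s \<in> {1..n i}" for i s x y
    unfolding Ts_def by (rule cadjoint_bounded(2)[OF bounded[OF that]])
  have Ts_comm: "Ts j t (Ts i s x) = cnj (lam i j s t) *\<^sub>C Ts i s (Ts j t x)"
    if "i \<in> {1..k}" "j \<in> {1..k}" "i \<noteq> j" "s \<in> {1..n i}" "t \<in> {1..n j}" for i j s t x
  proof (rule cinner_eqI)
    fix z
    have comm: "T i s (T j t z) = lam i j s t *\<^sub>C T j t (T i s z)" using T that by blast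
    have "cinner z (Ts j t (Ts i s x)) = cinner (T i s (T j t z)) x"
      by (simp only: adj[OF that(1,4)] adj[OF that(2,5)])
    also have "\<dots> = lam i j s t * cinner (T j t (T i s z)) x"
      unfolding comm by (rule cinner_scaleC_left)
    also have "\<dots> = cinner z (cnj (lam i j s t) *\<^sub>C Ts i s (Ts j t x))"
      by (simp add: adj[OF that(1,4)] adj[OF that(2,5)] cinner_scaleC_right)
    finally show "cinner z (Ts j t (Ts i s x)) = cinner z (cnj (lam i j s t) *\<^sub>C Ts i s (Ts j t x))" .
  qed
  \<comment> \<open>Positivity of I - \<Sum> T_s T_s^*, tested at x and rewritten by
    adjoints.\<close>
  have row: "(\<Sum>s\<in>{1..n i}. (norm (Ts i s x))\<^sup>2) \<le> (norm x)\<^sup>2" if i: "i \<in> {1..k}" for i x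
  proof -
    have "cinner (x - (\<Sum>s\<in>{1..n i}. T i s (cadjoint (T i s) x))) x \<in> \<real>\<^sub>\<ge>\<^sub>0"
      using T i unfolding positive_op_def by blast
    moreover have "cinner (x - (\<Sum>s\<in>{1..n i}. T i s (cadjoint (T i s) x))) x =
        of_real ((norm x)\<^sup>2 - (\<Sum>s\<in>{1..n i}. (norm (Ts i s x))\<^sup>2))"
    proof -
      have "cinner (T i s (cadjoint (T i s) x)) x = of_real ((norm (Ts i s x))\<^sup>2)" if "s \<in> {1..n i}" for s
        unfolding adj[OF i that] Ts_def by (rule cinner_self)
      then show ?thesis by (simp add: cinner_diff_left cinner_sum_left cinner_self del: of_real_power One_nat_def)
    qed
    ultimately show ?thesis by (simp only: nonneg_Reals_of_real_iff)
  qed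
  define C where "C r i s x = r *\<^sub>R Ts i s x" for r :: real and i s x
  have bound: "cmod (\<Sum>(\<alpha>, \<beta>)\<in>F. a \<alpha> \<beta> * cinner (foldr (\<lambda>i. fold (C r i) (\<beta> i)) [1..<Suc k] h)
      (fold (\<lambda>i. fold (C r i) (\<alpha> i)) [1..<Suc k] h')) \<le> K * norm h * norm h'"
    if r: "0 \<le> r" "r < 1" for r h h'
  proof -
    interpret twisted_contractions k n lam "C r" "r\<^sup>2"
    proof
      show "0 \<le> r\<^sup>2" "r\<^sup>2 < 1" using r by (auto simp: abs_square_less_1)
      show "twist k n lam" by fact
      show "clinear (C r i s)" if "i \<in> {1..k}" "s \<in> {1..n i}" for i s
        using Ts[OF that] unfolding bounded_clinear_def clinear_def C_def
        by (simp add: linear_add bounded_linear.linear scaleC_add_right scaleR_scaleC scaleC_scaleC mult.commute)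
      show "(\<Sum>s\<in>{1..n i}. (norm (C r i s x))\<^sup>2) \<le> r\<^sup>2 * (norm x)\<^sup>2" if "i \<in> {1..k}" for i x
        using row[OF that, of x]
        by (simp add: C_def power_mult_distrib sum_distrib_left[symmetric] mult_left_mono)
      show "C r j t (C r i s x) = cnj (lam i j s t) *\<^sub>C C r i s (C r j t x)"
        if ij: "i \<in> {1..k}" "j \<in> {1..k}" "i \<noteq> j" and st: "s \<in> {1..n i}" "t \<in> {1..n j}" for i j s t x
        using Ts_comm[OF ij st, of x] Ts[OF ij(1) st(1)] Ts[OF ij(2) st(2)]
        unfolding C_def bounded_clinear_def
        by (simp add: scaleR_scaleC scaleC_scaleC mult_ac)
    qed
    \<comment> \<open>The form of the operator defect is the iterated form defect. The vectors stay
      arbitrary in the induction because the inner operator is evaluated at \<open>Ts i s x\<close>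
      and \<open>Ts i s y\<close>; one factor r in each argument makes up r^2.\<close>
    have defect: "cinner (foldr (\<lambda>i X x. X x - row_map r (n i) (T i) X x) l (\<lambda>x. x) x) y =
        foldr (\<lambda>i B x y. B x y - pull (C r i) (n i) B x y) l cinner x y"
      if "set l \<subseteq> {1..k}" for l x y
      using that
    proof (induction l arbitrary: x y)
      case (Cons i l)
      then have i: "i \<in> {1..k}" and l: "set l \<subseteq> {1..k}" by auto
      let ?X = "foldr (\<lambda>i X x. X x - row_map r (n i) (T i) X x) l (\<lambda>x. x)"
        and ?B = "foldr (\<lambda>i B x y. B x y - pull (C r i) (n i) B x y) l cinner"
      have B: "hermitian_form ?B"
        by (rule hermitian_foldr[OF hermitian_D l hermitian_form_cinner])
      have "cinner (row_map r (n i) (T i) ?X x) y = pull (C r i) (n i) ?B x y"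
        unfolding row_map_def[of r "n i" "T i" ?X] pull_def[of "C r i" "n i" ?B] cinner_sum_left
      proof (rule sum.cong[OF refl])
        fix s assume s: "s \<in> {1..n i}"
        have "cinner (r\<^sup>2 *\<^sub>R T i s (?X (cadjoint (T i s) x))) y = of_real (r\<^sup>2) * ?B (Ts i s x) (Ts i s y)"
          unfolding scaleR_scaleC cinner_scaleC_left adj[OF i s] Ts_def[symmetric] Cons.IH[OF l] ..
        also have "\<dots> = ?B (C r i s x) (C r i s y)"
          unfolding C_def scaleR_scaleC hermitian_formD(2)[OF B] hermitian_formD(4)[OF B]
          by (simp add: power2_eq_square)
        finally show "cinner (r\<^sup>2 *\<^sub>R T i s (?X (cadjoint (T i s) x))) y = ?B (C r i s x) (C r i s y)" .
      qed
      then show ?case using Cons.IH[OF l, of x y] by (simp add: cinner_diff_left)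
    qed simp
    have "0 \<le> Re (\<Delta> x x)" for x
    proof -
      have "positive_op (foldr (\<lambda>i X x. X x - row_map r (n i) (T i) X x) [1..<Suc k] (\<lambda>x. x))"
        using T r unfolding atLeastLessThan_iff Ball_def by blast
      then have "cinner (foldr (\<lambda>i X x. X x - row_map r (n i) (T i) X x) [1..<Suc k] (\<lambda>x. x) x) x \<in> \<real>\<^sub>\<ge>\<^sub>0"
        unfolding positive_op_def by (rule spec)
      moreover have "set [1..<Suc k] \<subseteq> {1..k}" by auto
      ultimately have "\<Delta> x x \<in> \<real>\<^sub>\<ge>\<^sub>0"
        unfolding \<Delta>_def by (simp only: defect)
      then show ?thesis by (auto simp: complex_nonneg_Reals_iff)
    qed
    then show ?thesis using F K0 K by (rule poly_form_bound)
  qed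
  \<comment> \<open>The bound holds for r < 1 only, so r tends to 1 from the left; finitely many
    words are involved, and each letter is continuous.\<close>
  have lim: "((\<lambda>r. C r i s (g r)) \<longlongrightarrow> Ts i s x) (at_left 1)"
    if "i \<in> {1..k}" "s \<in> {1..n i}" "(g \<longlongrightarrow> x) (at_left 1)" for i s g x
  proof -
    have "((\<lambda>r. r *\<^sub>R Ts i s (g r)) \<longlongrightarrow> 1 *\<^sub>R Ts i s x) (at_left 1)"
      using Ts[OF that(1,2)] unfolding bounded_clinear_def
      by (intro tendsto_scaleR tendsto_ident_at bounded_linear.tendsto[OF _ that(3)]) simp
    then show ?thesis by (simp add: C_def)
  qed
  have lim_word: "((\<lambda>r. fold (C r i) (\<alpha> i) (g r)) \<longlongrightarrow> fold (Ts i) (\<alpha> i) x) (at_left 1)"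
    if "\<alpha> \<in> multiwords k n" "i \<in> set [1..<Suc k]" "(g \<longlongrightarrow> x) (at_left 1)" for \<alpha> i g x
    by (rule tendsto_fold[OF lim that(3)]) (use that(2) multiword_letter[OF that(1), of i] in auto)
  have form: "cmod (cinner (poly_op UNIV k F a T h) h') \<le> K * norm h * norm h'" for h h'
  proof (rule tendsto_upperbound)
    have pair: "adjoint_pair UNIV (T i s) (Ts i s)" if "i \<in> {1..k}" "s \<in> {1..n i}" for i s
      using adj[OF that] by (simp add: adjoint_pair_def)
    have "cinner (poly_op UNIV k F a T h) h' = (\<Sum>(\<alpha>, \<beta>)\<in>F. a \<alpha> \<beta> *
        cinner (foldr (\<lambda>i. fold (Ts i) (\<beta> i)) [1..<Suc k] h) (fold (\<lambda>i. fold (Ts i) (\<alpha> i)) [1..<Suc k] h'))"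
      by (rule cinner_poly_op[OF pair _ F(2)]) simp_all
    moreover have "((\<lambda>r. \<Sum>z\<in>F. case z of (\<alpha>, \<beta>) \<Rightarrow> a \<alpha> \<beta> *
        cinner (foldr (\<lambda>i. fold (C r i) (\<beta> i)) [1..<Suc k] h) (fold (\<lambda>i. fold (C r i) (\<alpha> i)) [1..<Suc k] h'))
      \<longlongrightarrow> (\<Sum>z\<in>F. case z of (\<alpha>, \<beta>) \<Rightarrow> a \<alpha> \<beta> *
        cinner (foldr (\<lambda>i. fold (Ts i) (\<beta> i)) [1..<Suc k] h) (fold (\<lambda>i. fold (Ts i) (\<alpha> i)) [1..<Suc k] h'))) (at_left 1)"
    proof (rule tendsto_sum)
      fix z assume "z \<in> F"
      then obtain \<alpha> \<beta> where z: "z = (\<alpha>, \<beta>)" "\<alpha> \<in> multiwords k n" "\<beta> \<in> multiwords k n" using F by blast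
      show "((\<lambda>r. case z of (\<alpha>, \<beta>) \<Rightarrow> a \<alpha> \<beta> *
        cinner (foldr (\<lambda>i. fold (C r i) (\<beta> i)) [1..<Suc k] h) (fold (\<lambda>i. fold (C r i) (\<alpha> i)) [1..<Suc k] h'))
      \<longlongrightarrow> (case z of (\<alpha>, \<beta>) \<Rightarrow> a \<alpha> \<beta> *
        cinner (foldr (\<lambda>i. fold (Ts i) (\<beta> i)) [1..<Suc k] h) (fold (\<lambda>i. fold (Ts i) (\<alpha> i)) [1..<Suc k] h'))) (at_left 1)"
        unfolding z(1) prod.case
        by (intro tendsto_mult_left bounded_bilinear.tendsto[OF bounded_bilinear_cinner]
            tendsto_foldr tendsto_fold[where l = "[1..<Suc k]"] lim_word[OF z(2)] lim_word[OF z(3)] tendsto_const)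
    qed
    ultimately show "((\<lambda>r. cmod (\<Sum>(\<alpha>, \<beta>)\<in>F. a \<alpha> \<beta> * cinner (foldr (\<lambda>i. fold (C r i) (\<beta> i)) [1..<Suc k] h)
      (fold (\<lambda>i. fold (C r i) (\<alpha> i)) [1..<Suc k] h'))) \<longlongrightarrow> cmod (cinner (poly_op UNIV k F a T h) h')) (at_left 1)"
      by (simp only: tendsto_norm)
    have "\<forall>\<^sub>F r in at_left (1::real). r \<in> {0<..<1}" by (rule eventually_at_left_real) simp
    then show "\<forall>\<^sub>F r in at_left 1. cmod (\<Sum>(\<alpha>, \<beta>)\<in>F. a \<alpha> \<beta> *
        cinner (foldr (\<lambda>i. fold (C r i) (\<beta> i)) [1..<Suc k] h)
        (fold (\<lambda>i. fold (C r i) (\<alpha> i)) [1..<Suc k] h')) \<le> K * norm h * norm h'"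
      by (rule eventually_mono) (rule bound, auto)
  qed simp
  \<comment> \<open>The form bound is tested with h' equal to the image of h, and one factor of the
    norm is cancelled.\<close>
  have "norm (poly_op UNIV k F a T h) \<le> K * norm h" for h
  proof (cases "poly_op UNIV k F a T h = 0")
    case False
    have "(norm (poly_op UNIV k F a T h))\<^sup>2 \<le> K * norm h * norm (poly_op UNIV k F a T h)"
      using form[of h "poly_op UNIV k F a T h"] by (simp only: cinner_self) (simp add: norm_power)
    then show ?thesis using False by (simp add: power2_eq_square)
  qed (use K0 in simp)
  then show ?thesis unfolding K_def[symmetric] by (intro onorm_bound K0)
qed

end
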